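(* Let $G$ be a simple undirected graph with vertex set $[m]$ such that the graphical model $\Theta(G)$ is reducible with decomposition $(\Gamma_1,T,\Gamma_2)$ of the clique complex $\mathcal C(G)$. Let $G_1,G_2$ be the subgraphs of $G$ whose clique complexes are $\Gamma_1,\Gamma_2$, with vertex sets $U$ and $W$ respectively. Let $\Sigma\in\Theta(G)$. Then $\log\mathrm{Vor}_G(\Sigma)$ equals $$\Big(\Big\{\big([S_1^{-1}]^{[m]}+[S_2^{-1}]^{[m]}-[\Sigma_{TT}^{-1}]^{[m]}\big)^{-1}:\ S_1\in\log\mathrm{Vor}_{G_1}(\Sigma_{UU}),\ S_2\in\log\mathrm{Vor}_{G_2}(\Sigma_{WW})\Big\}+\ker(\psi)\Big)\cap\mathrm{PD}_m,$$ where $+\ker(\psi)$ denotes Minkowski sum and $\psi:\mathrm{Sym}(\mathbb R^m)\to\mathrm{Sym}(\mathbb R^U)\times\mathrm{Sym}(\mathbb R^W)$ is the map $M\mapsto(M_{UU},M_{WW})$.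
   Context: $\mathrm{PD}_m$ is the cone of real symmetric positive definite $m\times m$ matrices, $[m]=\{1,\dots,m\}$, and $\mathrm{Sym}(\mathbb R^I)$ is the space of real symmetric matrices with rows and columns indexed by $I$ (with $\mathrm{Sym}(\mathbb R^m)$ for $I=[m]$). Graphical model: for a simple undirected graph $G$ with vertex set $V$, $\Theta(G)$ is the set of positive definite matrices $\Sigma$ indexed by $V$ with $(\Sigma^{-1})_{ij}=0$ whenever $i\ne j$ and $ij\notin E(G)$. Logarithmic Voronoi cell: a positive integer $n$ is fixed and $\ell_n(\Sigma,S)=-\frac n2\log\det\Sigma-\frac n2\mathrm{tr}(S\Sigma^{-1})$. For $\Sigma\in\Theta(G)$, $\log\mathrm{Vor}_G(\Sigma)$ is the set of positive definite matrices $S$ indexed by $V$ such that $\ell_n(\Sigma,S)\ge\ell_n(\Sigma',S)$ for all $\Sigma'\in\Theta(G)$. Reducibility: a clique of $G$ is a set $C\subseteq V$ with $ij\in E(G)$ for all distinct $i,j\in C$; $\mathcal C(G)$ is the simplicial complex of all cliques of $G$. A simplicial complex $\Gamma$ on $[m]$ is reducible with decomposition $(\Gamma_1,T,\Gamma_2)$ if $\Gamma_1,\Gamma_2$ are subcomplexes of $\Gamma$ and $T\subseteq[m]$ with $\Gamma=\Gamma_1\cup\Gamma_2$, $\Gamma_1\cap\Gamma_2=2^T$, and $\Gamma_i\ne 2^T$ for $i=1,2$. The model $\Theta(G)$ is reducible with decomposition $(\Gamma_1,T,\Gamma_2)$ if $\mathcal C(G)$ is. In that case each $\Gamma_i$ is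 the clique complex of a subgraph $G_i$ of $G$, and the intersection of $G_1$ and $G_2$ is the complete graph on $T$ (so $U\cup W=[m]$, $U\cap W=T$). Matrix notation: for an $m\times m$ matrix $A$ and $I,J\subseteq[m]$, $A_{IJ}$ is the submatrix with rows $I$ and columns $J$; $\Sigma_{TT}^{-1}$ means $(\Sigma_{TT})^{-1}$. For a matrix $B=(b_{ij})_{i\in I,j\in J}$, $[B]^{[m]}$ is the $m\times m$ matrix with $(i,j)$ entry $b_{ij}$ if $i\in I,j\in J$, and $0$ otherwise. *)

theory Defs
  imports
    Complex_Main
    "HOL-Library.Set_Algebras"
    "Jordan_Normal_Form.Determinant"
    "Jordan_Normal_Form.Gauss_Jordan_Elimination"
    "Jordan_Normal_Form.DL_Submatrix"
begin

text \<open>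
  Conventions. The vertex set $[m]$ is \<open>{0..<m}\<close>. A graph is given by a vertex set \<open>V\<close> and a
  set \<open>E\<close> of two-element edges. A matrix with rows and columns indexed by a finite \<open>I :: nat set\<close>
  is a matrix of dimension \<open>card I\<close>, its row and column number \<open>a\<close> standing for \<open>pick I a\<close>,
  the \<open>a\<close>-th smallest element of \<open>I\<close>. This is the convention of \<^const>\<open>submatrix\<close>; for
  \<open>I = {0..<m}\<close> it is the identity.
\<close>

definition simple_graph :: "nat set \<Rightarrow> nat set set \<Rightarrow> bool" where
  "simple_graph V E \<longleftrightarrow> finite V \<and> (\<forall>e\<in>E. \<exists>i\<in>V. \<exists>j\<in>V. i \<noteq> j \<and> e = {i, j})"

definition subgraph_of :: "nat set \<Rightarrow> nat set set \<Rightarrow> nat set \<Rightarrow> nat set set \<Rightarrow> bool" where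
  "subgraph_of U F V E \<longleftrightarrow> simple_graph U F \<and> U \<subseteq> V \<and> F \<subseteq> E"

definition clique_complex :: "nat set \<Rightarrow> nat set set \<Rightarrow> nat set set" where
  "clique_complex V E = {C. C \<subseteq> V \<and> (\<forall>i\<in>C. \<forall>j\<in>C. i \<noteq> j \<longrightarrow> {i, j} \<in> E)}"

definition simplicial_complex :: "nat set \<Rightarrow> nat set set \<Rightarrow> bool" where
  "simplicial_complex V \<Gamma> \<longleftrightarrow> \<Gamma> \<subseteq> Pow V \<and> (\<forall>A\<in>\<Gamma>. \<forall>B. B \<subseteq> A \<longrightarrow> B \<in> \<Gamma>)"

definition reducible_complex ::
  "nat set \<Rightarrow> nat set set \<Rightarrow> nat set set \<Rightarrow> nat set \<Rightarrow> nat set set \<Rightarrow> bool" where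
  "reducible_complex V \<Gamma> \<Gamma>\<^sub>1 T \<Gamma>\<^sub>2 \<longleftrightarrow>
     simplicial_complex V \<Gamma> \<and>
     simplicial_complex V \<Gamma>\<^sub>1 \<and> \<Gamma>\<^sub>1 \<subseteq> \<Gamma> \<and>
     simplicial_complex V \<Gamma>\<^sub>2 \<and> \<Gamma>\<^sub>2 \<subseteq> \<Gamma> \<and>
     T \<subseteq> V \<and>
     \<Gamma> = \<Gamma>\<^sub>1 \<union> \<Gamma>\<^sub>2 \<and> \<Gamma>\<^sub>1 \<inter> \<Gamma>\<^sub>2 = Pow T \<and>
     \<Gamma>\<^sub>1 \<noteq> Pow T \<and> \<Gamma>\<^sub>2 \<noteq> Pow T"

definition Sym :: "nat \<Rightarrow> real mat set" where
  "Sym k = {A \<in> carrier_mat k k. A\<^sup>T = A}"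

definition PD :: "nat \<Rightarrow> real mat set" where
  "PD k = {A \<in> Sym k. \<forall>x\<in>carrier_vec k. x \<noteq> 0\<^sub>v k \<longrightarrow> x \<bullet> (A *\<^sub>v x) > 0}"

text \<open>The inverse of an invertible matrix, with no meaning on singular ones.\<close>

definition minv :: "real mat \<Rightarrow> real mat" where
  "minv A = the (mat_inverse A)"

lemma minv_inverse:
  assumes A: "A \<in> carrier_mat k k" and d: "det A \<noteq> 0"
  shows "minv A \<in> carrier_mat k k" "A * minv A = 1\<^sub>m k" "minv A * A = 1\<^sub>m k"
proof -
  have "A \<in> Units (ring_mat TYPE(real) k ())"
    using det_non_zero_imp_unit[OF A d] .
  then obtain B where "mat_inverse A = Some B"
    using mat_inverse(1)[OF A, where b = "()"] by (cases "mat_inverse A") auto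
  with mat_inverse(2)[OF A] show "minv A \<in> carrier_mat k k" "A * minv A = 1\<^sub>m k" "minv A * A = 1\<^sub>m k"
    by (auto simp: minv_def)
qed

definition mtrace :: "real mat \<Rightarrow> real" where
  "mtrace A = (\<Sum>i<dim_row A. A $$ (i, i))"

definition graphical_model :: "nat set \<Rightarrow> nat set set \<Rightarrow> real mat set" where
  "graphical_model V E =
     {\<Sigma> \<in> PD (card V). \<forall>a<card V. \<forall>b<card V.
        a \<noteq> b \<and> {pick V a, pick V b} \<notin> E \<longrightarrow> minv \<Sigma> $$ (a, b) = 0}"

definition log_lik :: "nat \<Rightarrow> real mat \<Rightarrow> real mat \<Rightarrow> real" where
  "log_lik n \<Sigma> S = - (real n / 2) * ln (det \<Sigma>) - (real n / 2) * mtrace (S * minv \<Sigma>)"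

definition log_Vor :: "nat \<Rightarrow> nat set \<Rightarrow> nat set set \<Rightarrow> real mat \<Rightarrow> real mat set" where
  "log_Vor n V E \<Sigma> =
     {S \<in> PD (card V). \<forall>\<Sigma>'\<in>graphical_model V E. log_lik n \<Sigma> S \<ge> log_lik n \<Sigma>' S}"

text \<open>
  \<open>pad m I J B\<close> is $[B]^{[m]}$ for a matrix \<open>B\<close> with rows indexed by \<open>I\<close> and columns indexed by
  \<open>J\<close>. The number of elements of \<open>I\<close> below \<open>i \<in> I\<close> is the position of \<open>i\<close> in \<open>I\<close>, the \<open>a\<close>
  with \<open>pick I a = i\<close>.
\<close>

definition pad :: "nat \<Rightarrow> nat set \<Rightarrow> nat set \<Rightarrow> real mat \<Rightarrow> real mat" where
  "pad m I J B = mat m m (\<lambda>(i, j).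
     if i \<in> I \<and> j \<in> J then B $$ (card {k\<in>I. k < i}, card {k\<in>J. k < j}) else 0)"

definition \<psi> :: "nat set \<Rightarrow> nat set \<Rightarrow> real mat \<Rightarrow> real mat \<times> real mat" where
  "\<psi> U W M = (submatrix M U U, submatrix M W W)"

definition ker_\<psi> :: "nat \<Rightarrow> nat set \<Rightarrow> nat set \<Rightarrow> real mat set" where
  "ker_\<psi> m U W =
     {M \<in> Sym m. \<psi> U W M = (0\<^sub>m (card U) (card U), 0\<^sub>m (card W) (card W))}"

end

theory Submission
  imports Defs "Jordan_Normal_Form.Schur_Decomposition"
begin

text \<open>
  The logarithmic Voronoi cell of \<open>\<Sigma>\<close> is cut out of the positive definite cone by linear equations:
  \<open>S\<close> lies in it if and only if \<open>S\<close> agrees with \<open>\<Sigma>\<close> on the diagonal and on the edges of the graph. This is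
  Dempster's characterisation of the maximum likelihood estimate (\<open>log_Vor_eq\<close>). That the equations suffice
  is Gibbs' inequality \<open>log_det_le_trace\<close>; that they are necessary follows by testing optimality along
  rank-one changes \<open>K + t v v\<^sup>T\<close> of the inverse covariance matrix \<open>K\<close> (\<open>log_Vor_form_eq\<close>).

  For a reducible model every edge lies in \<open>G\<^sub>1\<close> or in \<open>G\<^sub>2\<close>, and \<open>\<Sigma>\<^sub>U\<^sub>U\<close> and \<open>\<Sigma>\<^sub>W\<^sub>W\<close> lie in the two smaller
  models (\<open>marginal_model\<close>). Hence a positive definite \<open>S\<close> lies in the cell of \<open>\<Sigma>\<close> if and only if its blocks
  \<open>S\<^sub>U\<^sub>U\<close> and \<open>S\<^sub>W\<^sub>W\<close> lie in the cells of \<open>\<Sigma>\<^sub>U\<^sub>U\<close> and \<open>\<Sigma>\<^sub>W\<^sub>W\<close>. It remains to recognise the right-hand side of the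
  theorem as the set of positive definite matrices with such blocks. Members \<open>S\<^sub>1\<close> and \<open>S\<^sub>2\<close> of the smaller
  cells have the same block \<open>\<Sigma>\<^sub>T\<^sub>T\<close>, as \<open>T\<close> is a clique of both graphs, and the matrix
  \<open>([S\<^sub>1\<^sup>-\<^sup>1] + [S\<^sub>2\<^sup>-\<^sup>1] - [\<Sigma>\<^sub>T\<^sub>T\<^sup>-\<^sup>1])\<^sup>-\<^sup>1\<close> has the blocks \<open>S\<^sub>1\<close> and \<open>S\<^sub>2\<close> (\<open>glue_inverse\<close>). Adding the kernel
  of \<open>\<psi>\<close> sweeps out all symmetric matrices with these two blocks.
\<close>

section \<open>Positive definite matrices\<close>

lemma PD_D:
  assumes "A \<in> PD k"
  shows "A \<in> carrier_mat k k" "A\<^sup>T = A"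
    "\<And>x. x \<in> carrier_vec k \<Longrightarrow> x \<noteq> 0\<^sub>v k \<Longrightarrow> x \<bullet> (A *\<^sub>v x) > 0"
  using assms by (auto simp: PD_def Sym_def)

lemma PD_I:
  assumes "A \<in> carrier_mat k k" "A\<^sup>T = A"
    "\<And>x. x \<in> carrier_vec k \<Longrightarrow> x \<noteq> 0\<^sub>v k \<Longrightarrow> x \<bullet> (A *\<^sub>v x) > 0"
  shows "A \<in> PD k"
  using assms by (auto simp: PD_def Sym_def)

lemma symmetric_index:
  assumes "(A :: 'a mat) \<in> carrier_mat k k" "A\<^sup>T = A" "a < k" "b < k"
  shows "A $$ (a, b) = A $$ (b, a)"
  using assms by (metis carrier_matD index_transpose_mat(1))

lemma bilinear_form_sum:
  fixes A :: "real mat"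
  assumes "A \<in> carrier_mat k k" "x \<in> carrier_vec k" "y \<in> carrier_vec k"
  shows "x \<bullet> (A *\<^sub>v y) = (\<Sum>a<k. \<Sum>b<k. x $ a * A $$ (a, b) * y $ b)"
  using assms by (auto simp: scalar_prod_def sum_distrib_left mult.assoc lessThan_atLeast0 intro!: sum.cong)

lemma symmetric_form_commute:
  fixes A :: "real mat"
  assumes "A \<in> carrier_mat k k" "A\<^sup>T = A" "x \<in> carrier_vec k" "y \<in> carrier_vec k"
  shows "x \<bullet> (A *\<^sub>v y) = y \<bullet> (A *\<^sub>v x)"
proof -
  have "x \<bullet> (A *\<^sub>v y) = (\<Sum>b<k. \<Sum>a<k. x $ a * A $$ (a, b) * y $ b)"
    unfolding bilinear_form_sum[OF assms(1,3,4)] by (rule sum.swap)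
  also have "\<dots> = (\<Sum>b<k. \<Sum>a<k. y $ b * A $$ (b, a) * x $ a)"
    by (intro sum.cong refl) (simp add: symmetric_index[OF assms(1,2)])
  finally show ?thesis unfolding bilinear_form_sum[OF assms(1,4,3)] .
qed

lemma PD_det_nonzero:
  assumes "A \<in> PD k"
  shows "det A \<noteq> 0"
proof
  assume "det A = 0"
  then obtain v where v: "v \<in> carrier_vec k" "v \<noteq> 0\<^sub>v k" "A *\<^sub>v v = 0\<^sub>v k"
    using det_0_iff_vec_prod_zero[OF PD_D(1)[OF assms]] by auto
  with PD_D(3)[OF assms v(1,2)] show False by simp
qed

lemmas PD_minv = minv_inverse[OF PD_D(1) PD_det_nonzero]

lemma minv_unique:
  assumes A: "A \<in> carrier_mat k k" and B: "B \<in> carrier_mat k k" and AB: "A * B = 1\<^sub>m k"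
  shows "minv A = B"
proof -
  have "det A * det B = 1" using det_mult[OF A B] AB by simp
  then have d: "det A \<noteq> 0" by auto
  note i = minv_inverse[OF A d]
  have "minv A = minv A * (A * B)" using i AB by simp
  also have "\<dots> = (minv A * A) * B" by (rule assoc_mult_mat[OF i(1) A B, symmetric])
  finally show ?thesis using i B by simp
qed

lemma minv_one: "minv (1\<^sub>m k) = 1\<^sub>m k"
  by (rule minv_unique) auto

lemma minv_minv:
  assumes A: "A \<in> PD k" shows "minv (minv A) = A"
  by (rule minv_unique[OF PD_minv(1)[OF A A] PD_D(1)[OF A] PD_minv(3)[OF A A]])

lemma minv_symmetric:
  assumes "A \<in> PD k" shows "(minv A)\<^sup>T = minv A"
proof -
  note A = PD_D(1,2)[OF assms] and i = PD_minv[OF assms assms]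
  have "A * (minv A)\<^sup>T = (minv A * A)\<^sup>T" using transpose_mult[OF i(1) A(1)] A(2) by simp
  also have "\<dots> = 1\<^sub>m k" using i by simp
  finally show ?thesis using minv_unique[OF A(1), of "(minv A)\<^sup>T"] i(1) by simp
qed

lemma PD_inverse:
  assumes "A \<in> PD k" shows "minv A \<in> PD k"
proof (rule PD_I)
  note A = PD_D(1,2)[OF assms] and i = PD_minv[OF assms assms]
  show "minv A \<in> carrier_mat k k" "(minv A)\<^sup>T = minv A" using i minv_symmetric[OF assms] by auto
  fix x :: "real vec" assume x: "x \<in> carrier_vec k" "x \<noteq> 0\<^sub>v k"
  define y where "y = minv A *\<^sub>v x"
  have y: "y \<in> carrier_vec k" using i x by (simp add: y_def)
  have Ay: "A *\<^sub>v y = x" using A i x by (simp add: y_def assoc_mult_mat_vec[symmetric, of _ k k _ k])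
  have "y \<noteq> 0\<^sub>v k" using Ay x A by auto
  with PD_D(3)[OF assms y] have "0 < y \<bullet> x" using Ay by simp
  then show "x \<bullet> (minv A *\<^sub>v x) > 0" using x y comm_scalar_prod[of x k y] by (simp add: y_def)
qed

lemma one_PD: "1\<^sub>m k \<in> PD k"
proof (rule PD_I)
  fix x :: "real vec" assume x: "x \<in> carrier_vec k" "x \<noteq> 0\<^sub>v k"
  then obtain i where i: "i < k" "x $ i \<noteq> 0"
    by (metis carrier_vecD eq_vecI index_zero_vec)
  have "x \<bullet> x = (\<Sum>j<k. (x $ j)\<^sup>2)"
    using x by (auto simp: scalar_prod_def power2_eq_square lessThan_atLeast0)
  also have "\<dots> > 0" using i by (intro sum_pos2[of _ i]) auto
  finally show "x \<bullet> (1\<^sub>m k *\<^sub>v x) > 0" using x by simp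
qed auto

section \<open>Gibbs' inequality for Gaussian log-likelihoods\<close>

text \<open>If \<open>w\<close> is \<open>minv B\<close> applied to an eigenvector, then \<open>A w = l B w\<close>. Testing this equation with the
  real part \<open>p\<close> and the imaginary part \<open>q\<close> of \<open>w\<close> keeps everything real: the cross terms
  \<open>p \<bullet> B q\<close> and \<open>q \<bullet> B p\<close> cancel by symmetry, which first forces \<open>Im l = 0\<close> and then exhibits \<open>l\<close>
  as the quotient of two positive numbers.\<close>
lemma pencil_eigenvalue_positive:
  assumes A: "A \<in> PD k" and B: "B \<in> PD k"
    and ev: "eigenvalue (map_mat complex_of_real (A * minv B)) l"
  shows "Im l = 0 \<and> Re l > 0"
proof -
  note cA = PD_D(1,2)[OF A] and cB = PD_D(1,2)[OF B] and iB = PD_minv[OF B B]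
  let ?C = "A * minv B"
  have C: "?C \<in> carrier_mat k k" using cA iB by simp
  obtain v where v: "v \<in> carrier_vec k" "v \<noteq> 0\<^sub>v k"
    and eq: "map_mat complex_of_real ?C *\<^sub>v v = l \<cdot>\<^sub>v v"
    using ev C unfolding eigenvalue_def eigenvector_def by auto
  define x where "x = map_vec Re v"
  define y where "y = map_vec Im v"
  have xy: "x \<in> carrier_vec k" "y \<in> carrier_vec k" using v by (auto simp: x_def y_def)
  have comp: "(\<Sum>b<k. complex_of_real (?C $$ (a, b)) * v $ b) = l * v $ a" if a: "a < k" for a
  proof -
    have "(map_mat complex_of_real ?C *\<^sub>v v) $ a = (\<Sum>b<k. complex_of_real (?C $$ (a, b)) * v $ b)"
      using a C v cA iB by (auto simp: scalar_prod_def lessThan_atLeast0 intro!: sum.cong)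
    then show ?thesis using eq a v by simp
  qed
  have row: "(M *\<^sub>v z) $ a = (\<Sum>b<k. M $$ (a, b) * z $ b)"
    if "a < k" "z \<in> carrier_vec k" "M \<in> carrier_mat k k" for a z and M :: "real mat"
    using that by (auto simp: scalar_prod_def lessThan_atLeast0 intro!: sum.cong)
  have Cx: "?C *\<^sub>v x = Re l \<cdot>\<^sub>v x - Im l \<cdot>\<^sub>v y"
  proof (rule eq_vecI)
    fix a assume "a < dim_vec (Re l \<cdot>\<^sub>v x - Im l \<cdot>\<^sub>v y)"
    then have a: "a < k" using xy by simp
    have "(?C *\<^sub>v x) $ a = Re (\<Sum>b<k. complex_of_real (?C $$ (a, b)) * v $ b)"
      using row[OF a xy(1) C] v by (simp add: x_def)
    then show "(?C *\<^sub>v x) $ a = (Re l \<cdot>\<^sub>v x - Im l \<cdot>\<^sub>v y) $ a"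
      unfolding comp[OF a] using a v by (simp add: x_def y_def)
  qed (use xy C in auto)
  have Cy: "?C *\<^sub>v y = Re l \<cdot>\<^sub>v y + Im l \<cdot>\<^sub>v x"
  proof (rule eq_vecI)
    fix a assume "a < dim_vec (Re l \<cdot>\<^sub>v y + Im l \<cdot>\<^sub>v x)"
    then have a: "a < k" using xy by simp
    have "(?C *\<^sub>v y) $ a = Im (\<Sum>b<k. complex_of_real (?C $$ (a, b)) * v $ b)"
      using row[OF a xy(2) C] v by (simp add: y_def)
    then show "(?C *\<^sub>v y) $ a = (Re l \<cdot>\<^sub>v y + Im l \<cdot>\<^sub>v x) $ a"
      unfolding comp[OF a] using a v by (simp add: x_def y_def)
  qed (use xy C in auto)
  define p where "p = minv B *\<^sub>v x"
  define q where "q = minv B *\<^sub>v y"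
  have pq: "p \<in> carrier_vec k" "q \<in> carrier_vec k" using iB xy by (auto simp: p_def q_def)
  have Bp: "B *\<^sub>v p = x" and Bq: "B *\<^sub>v q = y"
    using cB iB xy by (simp_all add: p_def q_def assoc_mult_mat_vec[symmetric, of _ k k _ k])
  have Ap: "A *\<^sub>v p = Re l \<cdot>\<^sub>v x - Im l \<cdot>\<^sub>v y" and Aq: "A *\<^sub>v q = Re l \<cdot>\<^sub>v y + Im l \<cdot>\<^sub>v x"
    using Cx Cy cA iB xy by (simp_all add: p_def q_def assoc_mult_mat_vec[of _ k k _ k])
  have cross: "p \<bullet> y = q \<bullet> x"
    using symmetric_form_commute[OF cB pq] by (simp add: Bp Bq)
  have pAp: "p \<bullet> (A *\<^sub>v p) = Re l * (p \<bullet> x) - Im l * (p \<bullet> y)"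
    unfolding Ap using pq xy by (simp add: scalar_prod_minus_distrib[of _ k])
  have qAq: "q \<bullet> (A *\<^sub>v q) = Re l * (q \<bullet> y) + Im l * (q \<bullet> x)"
    unfolding Aq using pq xy by (simp add: scalar_prod_add_distrib[of _ k])
  have pAq: "p \<bullet> (A *\<^sub>v q) = Re l * (p \<bullet> y) + Im l * (p \<bullet> x)"
    unfolding Aq using pq xy by (simp add: scalar_prod_add_distrib[of _ k])
  have qAp: "q \<bullet> (A *\<^sub>v p) = Re l * (q \<bullet> x) - Im l * (q \<bullet> y)"
    unfolding Ap using pq xy by (simp add: scalar_prod_minus_distrib[of _ k])
  have nonneg: "0 \<le> z \<bullet> (M *\<^sub>v z)" if "M \<in> PD k" "z \<in> carrier_vec k" for M and z :: "real vec"
    using PD_D[OF that(1)] that(2) by (cases "z = 0\<^sub>v k") (auto intro: less_imp_le)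
  have "x \<noteq> 0\<^sub>v k \<or> y \<noteq> 0\<^sub>v k"
  proof (rule ccontr)
    assume "\<not> ?thesis"
    then have "x = 0\<^sub>v k" "y = 0\<^sub>v k" by auto
    then have "Re (v $ a) = 0 \<and> Im (v $ a) = 0" if "a < k" for a
      using that v(1) unfolding x_def y_def
      by (metis carrier_vecD index_map_vec(1) index_zero_vec(1))
    then show False using v by (auto simp: complex_eq_iff)
  qed
  then have "p \<noteq> 0\<^sub>v k \<or> q \<noteq> 0\<^sub>v k"
    using Bp Bq cB by auto
  then have pos: "0 < M" if "M = p \<bullet> (D *\<^sub>v p) + q \<bullet> (D *\<^sub>v q)" "D \<in> PD k" for M D
    using PD_D(3)[OF that(2) pq(1)] PD_D(3)[OF that(2) pq(2)]
      nonneg[OF that(2) pq(1)] nonneg[OF that(2) pq(2)] that(1) by linarith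
  have posB: "0 < p \<bullet> x + q \<bullet> y" using pos[OF refl B] by (simp add: Bp Bq)
  have "Im l * (p \<bullet> x + q \<bullet> y) = 0"
    using pAq qAp symmetric_form_commute[OF cA pq] cross by (simp add: algebra_simps)
  then have "Im l = 0" using posB by simp
  moreover have "0 < Re l * (p \<bullet> x + q \<bullet> y)"
    using pos[OF refl A] pAp qAq \<open>Im l = 0\<close> by (simp add: algebra_simps)
  then have "0 < Re l" using posB by (simp add: zero_less_mult_iff)
  ultimately show ?thesis by simp
qed

lemma diagonal_sum_mult_commute:
  fixes X Y :: "'a :: comm_ring_1 mat"
  assumes "X \<in> carrier_mat k k" "Y \<in> carrier_mat k k"
  shows "(\<Sum>a<k. (X * Y) $$ (a, a)) = (\<Sum>a<k. (Y * X) $$ (a, a))"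
proof -
  have "(\<Sum>a<k. (X * Y) $$ (a, a)) = (\<Sum>a<k. \<Sum>b<k. X $$ (a, b) * Y $$ (b, a))"
    using assms by (intro sum.cong) (auto simp: scalar_prod_def lessThan_atLeast0)
  also have "\<dots> = (\<Sum>b<k. \<Sum>a<k. X $$ (a, b) * Y $$ (b, a))" by (rule sum.swap)
  also have "\<dots> = (\<Sum>b<k. (Y * X) $$ (b, b))"
    using assms by (intro sum.cong) (auto simp: scalar_prod_def lessThan_atLeast0 mult.commute)
  finally show ?thesis .
qed

text \<open>\<open>A * minv B\<close> need not be symmetric, so its eigenvalues are read off a complex Schur triangularisation;
  by the previous lemma they are nevertheless positive reals.\<close>
lemma pencil_eigenvalues:
  assumes A: "A \<in> PD k" and B: "B \<in> PD k"
  obtains r :: "nat \<Rightarrow> real" where "\<And>a. a < k \<Longrightarrow> r a > 0"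
    "det (A * minv B) = (\<Prod>a<k. r a)" "mtrace (A * minv B) = (\<Sum>a<k. r a)"
proof -
  let ?C = "A * minv B" and ?D = "map_mat complex_of_real (A * minv B)"
  have C: "?C \<in> carrier_mat k k" using PD_D(1)[OF A] PD_minv(1)[OF B B] by simp
  then have D: "?D \<in> carrier_mat k k" by simp
  obtain as where "char_poly ?D = (\<Prod>a\<leftarrow>as. [:- a, 1:])"
    using char_poly_factorized[OF D] by blast
  then obtain U where U: "U \<in> carrier_mat k k" "upper_triangular U" and sim: "similar_mat ?D U"
    using schur_decomposition_exists[OF D] by blast
  have cp: "char_poly ?D = (\<Prod>a\<leftarrow>diag_mat U. [:- a, 1:])"
    using char_poly_similar[OF sim] char_poly_upper_triangular[OF U] by simp
  have diag: "Im (U $$ (a, a)) = 0 \<and> Re (U $$ (a, a)) > 0" if a: "a < k" for a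
  proof -
    have "U $$ (a, a) \<in> set (diag_mat U)" using a U by (auto simp: diag_mat_def)
    then have "poly (char_poly ?D) (U $$ (a, a)) = 0"
      unfolding cp by (auto simp: poly_prod_list prod_list_zero_iff intro!: image_eqI)
    then have "eigenvalue ?D (U $$ (a, a))" using eigenvalue_root_char_poly[OF D] by simp
    then show ?thesis by (rule pencil_eigenvalue_positive[OF A B])
  qed
  define r where "r a = Re (U $$ (a, a))" for a
  have r: "U $$ (a, a) = complex_of_real (r a)" if "a < k" for a
    using diag[OF that] by (simp add: r_def complex_eq_iff)
  have "complex_of_real (det ?C) = det ?D" by simp
  also have "\<dots> = det U" by (rule det_similar[OF sim])
  also have "\<dots> = (\<Prod>a<k. U $$ (a, a))"
    using det_upper_triangular[OF U(2,1)] U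
    by (simp add: diag_mat_def prod.list_conv_set_nth lessThan_atLeast0 cong: prod.cong_simp)
  also have "\<dots> = complex_of_real (\<Prod>a<k. r a)" using r by simp
  finally have d: "det ?C = (\<Prod>a<k. r a)" using of_real_eq_iff by blast
  obtain P Q where PQ: "P \<in> carrier_mat k k" "Q \<in> carrier_mat k k" "Q * P = 1\<^sub>m k" "?D = P * U * Q"
    using similar_matD[OF sim] D U by auto
  have entry: "complex_of_real (M $$ (a, a)) = map_mat complex_of_real M $$ (a, a)"
    if "M \<in> carrier_mat k k" "a < k" for a M
    using that by simp
  have "complex_of_real (mtrace ?C) = (\<Sum>a<k. ?D $$ (a, a))"
    unfolding mtrace_def of_real_sum carrier_matD(1)[OF C]
    by (intro sum.cong refl entry[OF C]) simp
  also have "\<dots> = (\<Sum>a<k. ((P * U) * Q) $$ (a, a))" using PQ by simp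
  also have "\<dots> = (\<Sum>a<k. (Q * (P * U)) $$ (a, a))"
    using PQ U by (intro diagonal_sum_mult_commute) auto
  also have "Q * (P * U) = U" using assoc_mult_mat[OF PQ(2,1) U(1)] PQ(3) U(1) by simp
  also have "(\<Sum>a<k. U $$ (a, a)) = complex_of_real (\<Sum>a<k. r a)" using r by simp
  finally have t: "mtrace ?C = (\<Sum>a<k. r a)" using of_real_eq_iff by blast
  show ?thesis by (rule that[OF _ d t]) (use diag in \<open>simp add: r_def\<close>)
qed

text \<open>The case \<open>B = 1\<close> of the eigenvalue list.\<close>
lemma PD_det_pos:
  assumes "A \<in> PD k" shows "det A > 0"
proof -
  obtain r :: "nat \<Rightarrow> real" where r: "\<And>a. a < k \<Longrightarrow> r a > 0" "det (A * minv (1\<^sub>m k)) = (\<Prod>a<k. r a)"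
    using pencil_eigenvalues[OF assms one_PD] by blast
  have "(\<Prod>a<k. r a) > 0" by (intro prod_pos) (use r in auto)
  then show ?thesis using r(2) PD_D(1)[OF assms] by (simp add: minv_one)
qed

lemma det_minv:
  assumes "A \<in> PD k" shows "det (minv A) = 1 / det A"
proof -
  note i = PD_minv[OF assms assms]
  have "det A * det (minv A) = 1" using det_mult[OF PD_D(1)[OF assms] i(1)] i(2) by simp
  then show ?thesis using PD_det_nonzero[OF assms] by (simp add: field_simps)
qed

text \<open>Gibbs' inequality, the statement that the relative entropy of two centred Gaussians is nonnegative:
  sum \<open>ln r \<le> r - 1\<close> over the eigenvalues \<open>r\<close> of \<open>A * minv B\<close>. It says that \<open>\<Sigma>\<close> maximises
  \<open>\<Sigma>' \<mapsto> log_lik n \<Sigma>' \<Sigma>\<close>.\<close>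
lemma log_det_le_trace:
  assumes A: "A \<in> PD k" and B: "B \<in> PD k"
  shows "ln (det A) - ln (det B) \<le> mtrace (A * minv B) - real k"
proof -
  obtain r :: "nat \<Rightarrow> real" where r: "\<And>a. a < k \<Longrightarrow> r a > 0"
    "det (A * minv B) = (\<Prod>a<k. r a)" "mtrace (A * minv B) = (\<Sum>a<k. r a)"
    using pencil_eigenvalues[OF A B] by blast
  have "det (A * minv B) = det A / det B"
    using det_mult[OF PD_D(1)[OF A] PD_minv(1)[OF B B]] det_minv[OF B] by simp
  then have "ln (det A) - ln (det B) = ln (\<Prod>a<k. r a)"
    using r(2) PD_det_pos[OF A] PD_det_pos[OF B] by (simp add: ln_div)
  also have "\<dots> = (\<Sum>a<k. ln (r a))" by (rule ln_prod) (use r in force)+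
  also have "\<dots> \<le> (\<Sum>a<k. r a - 1)" by (intro sum_mono ln_le_minus_one) (use r in auto)
  finally show ?thesis using r(3) by (simp add: sum_subtractf)
qed

section \<open>Rank-one perturbations of a positive definite matrix\<close>

definition outer :: "real vec \<Rightarrow> real vec \<Rightarrow> real mat" where
  "outer u v = mat (dim_vec u) (dim_vec v) (\<lambda>(a, b). u $ a * v $ b)"

lemma outer_carrier [simp]:
  "u \<in> carrier_vec k \<Longrightarrow> v \<in> carrier_vec l \<Longrightarrow> outer u v \<in> carrier_mat k l"
  by (auto simp: outer_def)

text \<open>The bordered matrix with blocks \<open>1, -u, v\<^sup>T, 1\<close> factors into block triangular matrices in two ways, one
  giving its determinant as \<open>det (1 + u v\<^sup>T)\<close>, the other as the scalar \<open>1 + v \<bullet> u\<close>.\<close>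
lemma det_one_plus_outer:
  assumes u: "u \<in> carrier_vec k" and v: "v \<in> carrier_vec k"
  shows "det (1\<^sub>m k + outer u v) = 1 + v \<bullet> u"
proof -
  define c where "c = mat k 1 (\<lambda>(a, b). - u $ a)"
  define r where "r = mat 1 k (\<lambda>(a, b). v $ b)"
  define s where "s = mat 1 1 (\<lambda>_. 1 + v \<bullet> u)"
  define G where "G = 1\<^sub>m k + outer u v"
  have carr: "c \<in> carrier_mat k 1" "r \<in> carrier_mat 1 k" "s \<in> carrier_mat 1 1"
    "G \<in> carrier_mat k k"
    using u v by (auto simp: c_def r_def s_def G_def)
  let ?I = "1\<^sub>m k :: real mat" and ?J = "1\<^sub>m 1 :: real mat"
  have L: "four_block_mat ?I (0\<^sub>m k 1) r ?J * four_block_mat ?I c (0\<^sub>m 1 k) s = four_block_mat ?I c r ?J"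
  proof -
    have "r * c + s = ?J"
      using u v by (auto simp: c_def r_def s_def scalar_prod_def sum_negf)
    then show ?thesis using carr
      by (subst mult_four_block_mat[of _ k k _ 1 _ 1 _ _ k _ 1]) auto
  qed
  have R: "four_block_mat G c (0\<^sub>m 1 k) ?J * four_block_mat ?I (0\<^sub>m k 1) r ?J
      = four_block_mat ?I c r ?J"
  proof -
    have "G + c * r = ?I"
      using u v by (auto simp: G_def c_def r_def outer_def scalar_prod_def)
    then show ?thesis using carr
      by (subst mult_four_block_mat[of _ k k _ 1 _ 1 _ _ k _ 1]) auto
  qed
  have "det (four_block_mat ?I c r ?J) = det s"
    unfolding L[symmetric] using carr
    by (subst det_mult[of _ "k + 1"])
      (auto simp: det_four_block_mat_upper_right_zero[of _ k _ 1] det_four_block_mat_lower_left_zero[of _ k _ 1])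
  moreover have "det (four_block_mat ?I c r ?J) = det G"
    unfolding R[symmetric] using carr
    by (subst det_mult[of _ "k + 1"])
      (auto simp: det_four_block_mat_upper_right_zero[of _ k _ 1] det_four_block_mat_lower_left_zero[of _ k _ 1])
  moreover have "det s = 1 + v \<bullet> u" by (simp add: s_def det_single)
  ultimately show ?thesis by (simp add: G_def)
qed

lemma outer_index [simp]:
  "u \<in> carrier_vec k \<Longrightarrow> v \<in> carrier_vec l \<Longrightarrow> a < k \<Longrightarrow> b < l \<Longrightarrow> outer u v $$ (a, b) = u $ a * v $ b"
  by (auto simp: outer_def)

lemma mult_outer:
  assumes "A \<in> carrier_mat k k" "u \<in> carrier_vec k" "v \<in> carrier_vec k"
  shows "A * outer u v = outer (A *\<^sub>v u) v"
  using assms by (auto intro!: eq_matI simp: outer_def scalar_prod_def sum_distrib_right mult.assoc)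

lemma outer_smult:
  assumes "u \<in> carrier_vec k" "v \<in> carrier_vec k"
  shows "outer (t \<cdot>\<^sub>v u) v = t \<cdot>\<^sub>m outer u v"
  using assms by (auto intro!: eq_matI simp: outer_def)

lemma outer_form:
  assumes "v \<in> carrier_vec k" "x \<in> carrier_vec k"
  shows "x \<bullet> (outer v v *\<^sub>v x) = (v \<bullet> x)\<^sup>2"
proof -
  have "x \<bullet> (outer v v *\<^sub>v x) = (\<Sum>a<k. \<Sum>b<k. (v $ a * x $ a) * (v $ b * x $ b))"
    using assms by (subst bilinear_form_sum[of _ k]) (auto intro!: sum.cong)
  also have "\<dots> = (v \<bullet> x)\<^sup>2"
    using assms by (simp add: scalar_prod_def lessThan_atLeast0 power2_eq_square sum_product)
  finally show ?thesis .
qed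

lemma det_rank_one_update:
  assumes K: "K \<in> PD k" and v: "v \<in> carrier_vec k"
  shows "det (K + t \<cdot>\<^sub>m outer v v) = det K * (1 + t * (v \<bullet> (minv K *\<^sub>v v)))"
proof -
  note cK = PD_D(1)[OF K] and i = PD_minv[OF K K]
  let ?u = "minv K *\<^sub>v v"
  have u: "?u \<in> carrier_vec k" using i v by simp
  have Ku: "K *\<^sub>v ?u = v" using cK i v by (simp add: assoc_mult_mat_vec[symmetric, of _ k k _ k])
  have tu: "t \<cdot>\<^sub>v ?u \<in> carrier_vec k" using u by simp
  have "K * (1\<^sub>m k + outer (t \<cdot>\<^sub>v ?u) v) = K + t \<cdot>\<^sub>m outer v v"
    using cK tu u v Ku by (simp add: mult_add_distrib_mat[of _ k k _ k] mult_outer[of _ k] mult_smult_distrib[of _ k k _ k] outer_smult[of _ k])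
  then have "det (K + t \<cdot>\<^sub>m outer v v) = det K * (1 + v \<bullet> (t \<cdot>\<^sub>v ?u))"
    using det_mult[OF cK, of "1\<^sub>m k + outer (t \<cdot>\<^sub>v ?u) v"] det_one_plus_outer[OF tu v] tu v by simp
  then show ?thesis using u v by simp
qed

text \<open>The Cauchy--Schwarz inequality of the scalar product given by \<open>K\<close>, for the vectors \<open>minv K *\<^sub>v v\<close>
  and \<open>x\<close>. It bounds how much of \<open>v v\<^sup>T\<close> may be subtracted from \<open>K\<close> before positivity is lost.\<close>
lemma PD_cauchy_schwarz:
  assumes K: "K \<in> PD k" and v: "v \<in> carrier_vec k" "v \<noteq> 0\<^sub>v k" and x: "x \<in> carrier_vec k"
  shows "(v \<bullet> x)\<^sup>2 \<le> (v \<bullet> (minv K *\<^sub>v v)) * (x \<bullet> (K *\<^sub>v x))"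
proof -
  note cK = PD_D(1,2)[OF K] and i = PD_minv[OF K K]
  define u where "u = minv K *\<^sub>v v"
  define a where "a = v \<bullet> u"
  define s where "s = (v \<bullet> x) / a"
  have u: "u \<in> carrier_vec k" using i v by (simp add: u_def)
  have Ku: "K *\<^sub>v u = v" using cK i v by (simp add: u_def assoc_mult_mat_vec[symmetric, of _ k k _ k])
  have a: "a > 0" using PD_D(3)[OF PD_inverse[OF K] v] by (simp add: a_def u_def)
  define y where "y = x - s \<cdot>\<^sub>v u"
  have y: "y \<in> carrier_vec k" using x u by (simp add: y_def)
  have Kx: "K *\<^sub>v x \<in> carrier_vec k" using cK x by simp
  have Ky: "K *\<^sub>v y = K *\<^sub>v x - s \<cdot>\<^sub>v v"
    using cK x u Ku by (simp add: y_def mult_minus_distrib_mat_vec[of _ k k] mult_mat_vec[of _ k k])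
  have uKx: "u \<bullet> (K *\<^sub>v x) = v \<bullet> x"
    using symmetric_form_commute[OF cK u x] Ku comm_scalar_prod[OF v(1) x] by simp
  have "0 \<le> y \<bullet> (K *\<^sub>v y)"
    using PD_D(3)[OF K y] cK by (cases "y = 0\<^sub>v k") (auto intro: less_imp_le)
  also have "\<dots> = x \<bullet> (K *\<^sub>v x) - s * (x \<bullet> v) - s * (u \<bullet> (K *\<^sub>v x)) + s * s * (u \<bullet> v)"
    unfolding Ky unfolding y_def using x u v Kx
    by (simp add: scalar_prod_minus_distrib[of _ k] minus_scalar_prod_distrib[of _ k] algebra_simps)
  also have "\<dots> = x \<bullet> (K *\<^sub>v x) - (v \<bullet> x)\<^sup>2 / a"
    unfolding uKx using comm_scalar_prod[OF v(1) x] comm_scalar_prod[OF v(1) u] a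
    by (simp add: s_def a_def[symmetric] power2_eq_square field_simps)
  finally show ?thesis using a by (simp add: a_def u_def field_simps)
qed

section \<open>Dempster's description of the logarithmic Voronoi cell\<close>

lemma mtrace_mult:
  assumes "A \<in> carrier_mat k k" "B \<in> carrier_mat k k"
  shows "mtrace (A * B) = (\<Sum>a<k. \<Sum>b<k. A $$ (a, b) * B $$ (b, a))"
  using assms unfolding mtrace_def by (auto simp: scalar_prod_def lessThan_atLeast0 intro!: sum.cong)

text \<open>The directions \<open>v\<close> for which \<open>v v\<^sup>T\<close> may be added to the inverse of a matrix of the model without
  leaving the zero pattern that defines the model.\<close>
definition rank_one_direction :: "nat set \<Rightarrow> nat set set \<Rightarrow> real vec \<Rightarrow> bool" where
  "rank_one_direction V E v \<longleftrightarrow> v \<in> carrier_vec (card V) \<and> v \<noteq> 0\<^sub>v (card V) \<and>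
     (\<forall>a<card V. \<forall>b<card V. a \<noteq> b \<and> {pick V a, pick V b} \<notin> E \<longrightarrow> v $ a * v $ b = 0)"

text \<open>The optimality condition along the line \<open>K + t v v\<^sup>T\<close>, where \<open>K = minv \<Sigma>\<close>. With
  \<open>a = v \<bullet> \<Sigma> v\<close> and \<open>b = v \<bullet> S v\<close>, the log-likelihood changes by \<open>n / 2\<close> times \<open>ln (1 + t a) - t b\<close>, by the
  rank-one formula for the determinant. Instead of differentiating at \<open>t = 0\<close>, the maximum of this function
  is inserted; its value \<open>r - 1 - ln r\<close>, \<open>r = b / a\<close>, must not be positive, and this leaves only \<open>r = 1\<close>.\<close>
lemma log_Vor_form_eq:
  assumes n: "n \<ge> 1" and Sig: "\<Sigma> \<in> graphical_model V E" and S: "S \<in> log_Vor n V E \<Sigma>"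
    and dir: "rank_one_direction V E v"
  shows "v \<bullet> (S *\<^sub>v v) = v \<bullet> (\<Sigma> *\<^sub>v v)"
proof -
  define k where "k = card V"
  have PS: "\<Sigma> \<in> PD k" and zero: "\<And>a b. a < k \<Longrightarrow> b < k \<Longrightarrow> a \<noteq> b \<Longrightarrow> {pick V a, pick V b} \<notin> E \<Longrightarrow> minv \<Sigma> $$ (a, b) = 0"
    using Sig by (auto simp: graphical_model_def k_def)
  have SPD: "S \<in> PD k" and opt: "\<And>\<Sigma>'. \<Sigma>' \<in> graphical_model V E \<Longrightarrow> log_lik n \<Sigma>' S \<le> log_lik n \<Sigma> S"
    using S by (auto simp: log_Vor_def k_def)
  have v: "v \<in> carrier_vec k" "v \<noteq> 0\<^sub>v k"
    and vz: "\<And>a b. a < k \<Longrightarrow> b < k \<Longrightarrow> a \<noteq> b \<Longrightarrow> {pick V a, pick V b} \<notin> E \<Longrightarrow> v $ a * v $ b = 0"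
    using dir by (auto simp: rank_one_direction_def k_def)
  define K where "K = minv \<Sigma>"
  have K: "K \<in> PD k" unfolding K_def by (rule PD_inverse[OF PS])
  have cK: "K \<in> carrier_mat k k" "K\<^sup>T = K" by (rule PD_D[OF K])+
  have cS: "S \<in> carrier_mat k k" by (rule PD_D[OF SPD])
  have mK: "minv K = \<Sigma>" unfolding K_def by (rule minv_minv[OF PS])
  define a where "a = v \<bullet> (\<Sigma> *\<^sub>v v)"
  define b where "b = v \<bullet> (S *\<^sub>v v)"
  have ab: "a > 0" "b > 0" using PD_D(3)[OF PS v] PD_D(3)[OF SPD v] by (auto simp: a_def b_def)
  \<comment> \<open>the maximiser of \<open>ln (1 + t * a) - t * b\<close>, where \<open>1 + t * a = a / b\<close>\<close>
  define t where "t = 1 / b - 1 / a"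
  have ta: "1 + t * a = a / b" using ab by (simp add: t_def field_simps)
  have tb: "t * b = 1 - b / a" using ab by (simp add: t_def field_simps)
  define A where "A = K + t \<cdot>\<^sub>m outer v v"
  have cO: "outer v v \<in> carrier_mat k k" using v by simp
  have cA: "A \<in> carrier_mat k k" using cK cO by (simp add: A_def)
  have iA: "A $$ (c, d) = K $$ (c, d) + t * (v $ c * v $ d)" if "c < k" "d < k" for c d
    using that v by (simp add: A_def carrier_matD[OF cO])
  have A: "A \<in> PD k"
  proof (rule PD_I[OF cA])
    show "A\<^sup>T = A"
    proof (rule eq_matI)
      fix c d assume "c < dim_row A" "d < dim_col A"
      then have "c < k" "d < k" using cA by auto
      then show "A\<^sup>T $$ (c, d) = A $$ (c, d)"
        using cA iA symmetric_index[OF cK] by simp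
    qed (use cA in auto)
    fix x :: "real vec" assume x: "x \<in> carrier_vec k" "x \<noteq> 0\<^sub>v k"
    have q: "x \<bullet> (K *\<^sub>v x) > 0" by (rule PD_D(3)[OF K x])
    have cs: "(v \<bullet> x)\<^sup>2 \<le> a * (x \<bullet> (K *\<^sub>v x))"
      using PD_cauchy_schwarz[OF K v x(1)] by (simp add: mK a_def)
    have "(t \<cdot>\<^sub>m outer v v) *\<^sub>v x = t \<cdot>\<^sub>v (outer v v *\<^sub>v x)"
      using carrier_matD[OF cO] x by (intro eq_vecI) (simp_all add: scalar_prod_def sum_distrib_left mult.assoc)
    then have "x \<bullet> (A *\<^sub>v x) = x \<bullet> (K *\<^sub>v x) + t * (v \<bullet> x)\<^sup>2"
      unfolding A_def using x v cK mult_mat_vec_carrier[OF cO x(1)]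
      by (simp add: add_mult_distrib_mat_vec[of _ k k] scalar_prod_add_distrib[of _ k] outer_form[of _ k])
    \<comment> \<open>for negative \<open>t\<close> the form is at least \<open>1 + t * a > 0\<close> times that of \<open>K\<close>\<close>
    also have "\<dots> > 0"
    proof (cases "t \<ge> 0")
      case True
      then show ?thesis using q by (simp add: add_pos_nonneg)
    next
      case False
      then have "t * (a * (x \<bullet> (K *\<^sub>v x))) \<le> t * (v \<bullet> x)\<^sup>2"
        using cs by (intro mult_left_mono_neg) auto
      moreover have "0 < (1 + t * a) * (x \<bullet> (K *\<^sub>v x))" using q ab by (simp add: ta)
      ultimately show ?thesis by (simp add: algebra_simps)
    qed
    finally show "x \<bullet> (A *\<^sub>v x) > 0" .
  qed
  have "minv A \<in> graphical_model V E"
    unfolding graphical_model_def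
    using PD_inverse[OF A] minv_minv[OF A] iA zero vz by (auto simp: k_def[symmetric] K_def)
  from opt[OF this] have le: "log_lik n (minv A) S \<le> log_lik n \<Sigma> S" .
  have trA: "mtrace (S * A) = mtrace (S * K) + t * b"
  proof -
    have "mtrace (S * A) = (\<Sum>c<k. \<Sum>d<k. S $$ (c, d) * K $$ (d, c) + t * (v $ c * S $$ (c, d) * v $ d))"
      unfolding mtrace_mult[OF cS cA] by (intro sum.cong refl) (simp add: iA algebra_simps)
    also have "\<dots> = mtrace (S * K) + t * b"
      unfolding mtrace_mult[OF cS cK(1)] b_def bilinear_form_sum[OF cS v(1) v(1)]
      by (simp add: sum.distrib sum_distrib_left)
    finally show ?thesis .
  qed
  have detA: "det A = det K * (a / b)"
    using det_rank_one_update[OF K v(1), of t] by (simp add: A_def mK a_def[symmetric] ta)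
  have pK: "det K > 0" by (rule PD_det_pos[OF K])
  have lS: "log_lik n \<Sigma> S = real n / 2 * (ln (det K) - mtrace (S * K))"
    using det_minv[OF K] pK by (simp add: log_lik_def K_def[symmetric] mK ln_div algebra_simps)
  have lA: "log_lik n (minv A) S = real n / 2 * (ln (det A) - mtrace (S * A))"
    using det_minv[OF A] PD_det_pos[OF A] by (simp add: log_lik_def minv_minv[OF A] ln_div algebra_simps)
  have "ln (det A) - mtrace (S * A) \<le> ln (det K) - mtrace (S * K)"
    using le n unfolding lS lA by (simp add: mult_le_cancel_left)
  then have "ln (a / b) \<le> t * b"
    using ln_mult_pos[OF pK, of "a / b"] ab unfolding trA detA by simp
  then have "b / a - 1 \<le> ln (b / a)" using ab tb by (simp add: ln_div)
  then have "ln (b / a) = b / a - 1" using ln_le_minus_one[of "b / a"] ab by simp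
  then have "b / a = 1" using ln_eq_minus_one[of "b / a"] ab by simp
  then show ?thesis using ab by (simp add: a_def b_def)
qed

text \<open>Dempster's likelihood equations. If \<open>S\<close> and \<open>\<Sigma>\<close> agree on the diagonal and on the edges, then the
  likelihood of every model matrix is the same for the data \<open>S\<close> as for the data \<open>\<Sigma>\<close>, because its inverse
  vanishes at the other entries, and Gibbs' inequality applies. Conversely, the vectors \<open>e\<^sub>a\<close>, and
  \<open>e\<^sub>a + e\<^sub>b\<close> for an edge \<open>ab\<close>, are rank-one directions, so the quadratic forms of \<open>S\<close> and \<open>\<Sigma>\<close> agree at
  them; polarisation gives the entries.\<close>
lemma log_Vor_eq:
  assumes n: "n \<ge> 1" and Sig: "\<Sigma> \<in> graphical_model V E"
  shows "log_Vor n V E \<Sigma> = {S \<in> PD (card V). \<forall>a<card V. \<forall>b<card V.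
     a = b \<or> {pick V a, pick V b} \<in> E \<longrightarrow> S $$ (a, b) = \<Sigma> $$ (a, b)}" (is "_ = ?R")
proof (intro equalityI subsetI)
  define k where "k = card V"
  have PS: "\<Sigma> \<in> PD k" using Sig by (auto simp: graphical_model_def k_def)
  note cSig = PD_D(1,2)[OF PS]
  {
    fix S assume S: "S \<in> log_Vor n V E \<Sigma>"
    then have SPD: "S \<in> PD k" by (auto simp: log_Vor_def k_def)
    note cS = PD_D(1,2)[OF SPD]
    note eq = log_Vor_form_eq[OF n Sig S]
    have form1: "unit_vec k a \<bullet> (M *\<^sub>v unit_vec k a) = M $$ (a, a)"
      if "M \<in> carrier_mat k k" "a < k" for M :: "real mat" and a
      using that by simp
    have diag: "S $$ (a, a) = \<Sigma> $$ (a, a)" if a: "a < k" for a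
    proof -
      have "rank_one_direction V E (unit_vec k a)"
        using a by (auto simp: rank_one_direction_def k_def[symmetric])
      from eq[OF this] show ?thesis by (simp only: form1[OF cS(1) a] form1[OF cSig(1) a])
    qed
    have off: "S $$ (a, b) = \<Sigma> $$ (a, b)"
      if a: "a < k" and b: "b < k" and ne: "a \<noteq> b" and ed: "{pick V a, pick V b} \<in> E" for a b
    proof -
      let ?v = "unit_vec k a + unit_vec k b :: real vec"
      have "?v $ a \<noteq> 0" using a b ne by simp
      then have "?v \<noteq> 0\<^sub>v k" using a by (metis index_zero_vec(1))
      then have dir: "rank_one_direction V E ?v"
        using a b ed by (auto simp: rank_one_direction_def k_def[symmetric] insert_commute)
      have form2: "?v \<bullet> (M *\<^sub>v ?v) = M $$ (a, a) + 2 * M $$ (a, b) + M $$ (b, b)"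
        if "M \<in> carrier_mat k k" "M\<^sup>T = M" for M :: "real mat"
        using that a b symmetric_index[OF that a b]
        by (simp add: mult_add_distrib_mat_vec[of _ k k] scalar_prod_add_distrib[of _ k] add_scalar_prod_distrib[of _ k])
      show ?thesis using eq[OF dir] diag[OF a] diag[OF b] unfolding form2[OF cS] form2[OF cSig] by simp
    qed
    show "S \<in> ?R" using SPD diag off by (auto simp: k_def)
  next
    fix S assume "S \<in> ?R"
    then have SPD: "S \<in> PD k"
      and agree: "\<And>a b. a < k \<Longrightarrow> b < k \<Longrightarrow> a = b \<or> {pick V a, pick V b} \<in> E \<Longrightarrow> S $$ (a, b) = \<Sigma> $$ (a, b)"
      by (auto simp: k_def)
    have cS: "S \<in> carrier_mat k k" by (rule PD_D[OF SPD])
    have tr: "mtrace (S * minv \<Sigma>') = mtrace (\<Sigma> * minv \<Sigma>')" if m: "\<Sigma>' \<in> graphical_model V E" for \<Sigma>'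
    proof -
      have P: "\<Sigma>' \<in> PD k"
        and z: "\<And>a b. a < k \<Longrightarrow> b < k \<Longrightarrow> a \<noteq> b \<Longrightarrow> {pick V a, pick V b} \<notin> E \<Longrightarrow> minv \<Sigma>' $$ (a, b) = 0"
        using m by (auto simp: graphical_model_def k_def)
      have "S $$ (a, b) * minv \<Sigma>' $$ (b, a) = \<Sigma> $$ (a, b) * minv \<Sigma>' $$ (b, a)" if "a < k" "b < k" for a b
        using agree[OF that] z[OF that(2,1)] by (cases "a = b \<or> {pick V a, pick V b} \<in> E") (auto simp: insert_commute)
      then show ?thesis
        unfolding mtrace_mult[OF cS PD_minv(1)[OF P P]] mtrace_mult[OF cSig(1) PD_minv(1)[OF P P]]
        by (intro sum.cong refl) simp
    qed
    have "log_lik n \<Sigma>' S \<le> log_lik n \<Sigma> S" if m: "\<Sigma>' \<in> graphical_model V E" for \<Sigma>'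
    proof -
      have P: "\<Sigma>' \<in> PD k" using m by (auto simp: graphical_model_def k_def)
      have "mtrace (\<Sigma> * minv \<Sigma>) = real k"
        using PD_minv(2)[OF PS PS] by (simp add: mtrace_def)
      then have "- ln (det \<Sigma>') - mtrace (S * minv \<Sigma>') \<le> - ln (det \<Sigma>) - mtrace (S * minv \<Sigma>)"
        using log_det_le_trace[OF PS P] tr[OF m] tr[OF Sig] by linarith
      then have "real n / 2 * (- ln (det \<Sigma>') - mtrace (S * minv \<Sigma>')) \<le> real n / 2 * (- ln (det \<Sigma>) - mtrace (S * minv \<Sigma>))"
        by (intro mult_left_mono) auto
      then show ?thesis by (simp add: log_lik_def algebra_simps)
    qed
    then show "S \<in> log_Vor n V E \<Sigma>" using SPD by (auto simp: log_Vor_def k_def)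
  }
qed

section \<open>Matrices indexed by finite sets\<close>

text \<open>Addressing an entry by vertices rather than by positions lets matrices on overlapping index sets be
  compared and multiplied directly; from here on, positions occur only in the transfer lemmas.\<close>
definition entry :: "nat set \<Rightarrow> real mat \<Rightarrow> nat \<Rightarrow> nat \<Rightarrow> real" where
  "entry I A i j = A $$ (card {k\<in>I. k < i}, card {k\<in>I. k < j})"

lemma position_less:
  fixes I :: "nat set"
  assumes "finite I" "i \<in> I" shows "card {k\<in>I. k < i} < card I"
proof (rule psubset_card_mono)
  have "i \<notin> {k\<in>I. k < i}" by simp
  then show "{k\<in>I. k < i} \<subset> I" using assms(2) by (metis (no_types, lifting) mem_Collect_eq psubsetI subsetI)
qed (rule assms)

lemma bij_betw_pick:
  assumes "finite I" shows "bij_betw (pick I) {..<card I} I"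
  by (rule bij_betw_byWitness[where f' = "\<lambda>i. card {k\<in>I. k < i}"])
    (use assms in \<open>auto simp: card_pick pick_card_in_set pick_in_set position_less\<close>)

lemma entry_pick:
  "a < card I \<Longrightarrow> b < card I \<Longrightarrow> entry I A (pick I a) (pick I b) = A $$ (a, b)"
  by (simp add: entry_def card_pick)

lemma ball_pick:
  assumes "finite I"
  shows "(\<forall>a<card I. P (pick I a)) \<longleftrightarrow> (\<forall>i\<in>I. P i)"
proof -
  have "I = pick I ` {..<card I}" using bij_betw_pick[OF assms] by (simp add: bij_betw_def)
  then show ?thesis by (metis imageE imageI lessThan_iff)
qed

lemma sum_pick: "finite I \<Longrightarrow> (\<Sum>a<card I. f (pick I a)) = (\<Sum>i\<in>I. f i)"
  by (rule sum.reindex_bij_betw[OF bij_betw_pick])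

lemma mat_eq_entryI:
  assumes "finite I" "A \<in> carrier_mat (card I) (card I)" "B \<in> carrier_mat (card I) (card I)"
    and "\<And>i j. i \<in> I \<Longrightarrow> j \<in> I \<Longrightarrow> entry I A i j = entry I B i j"
  shows "A = B"
proof (rule eq_matI)
  fix a b assume "a < dim_row B" "b < dim_col B"
  then have "a < card I" "b < card I" using assms by auto
  then show "A $$ (a, b) = B $$ (a, b)"
    using assms(4)[of "pick I a" "pick I b"] by (simp add: entry_pick pick_in_set)
qed (use assms in auto)

lemma entry_mult:
  assumes "finite I" "A \<in> carrier_mat (card I) (card I)" "B \<in> carrier_mat (card I) (card I)"
    and "i \<in> I" "j \<in> I"
  shows "entry I (A * B) i j = (\<Sum>k\<in>I. entry I A i k * entry I B k j)"
proof -
  let ?p = "\<lambda>i. card {k\<in>I. k < i}"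
  have "entry I (A * B) i j = (\<Sum>c<card I. A $$ (?p i, c) * B $$ (c, ?p j))"
    using assms position_less[of I] by (simp add: entry_def scalar_prod_def lessThan_atLeast0)
  also have "\<dots> = (\<Sum>c<card I. entry I A i (pick I c) * entry I B (pick I c) j)"
    by (intro sum.cong refl) (simp add: entry_def card_pick)
  finally show ?thesis using sum_pick[OF assms(1), of "\<lambda>k. entry I A i k * entry I B k j"] by simp
qed

lemma entry_one:
  assumes "finite I" "i \<in> I" "j \<in> I"
  shows "entry I (1\<^sub>m (card I)) i j = (if i = j then 1 else 0)"
  using assms position_less[of I] by (auto simp: entry_def) (metis pick_card_in_set)

lemma entry_interval:
  assumes "i < m" "j < m" shows "entry {0..<m} A i j = A $$ (i, j)"
proof -
  have "{k \<in> {0..<m}. k < l} = {..<l}" if "l < m" for l using that by auto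
  then show ?thesis using assms by (simp add: entry_def)
qed

lemma pad_index:
  "i < m \<Longrightarrow> j < m \<Longrightarrow> pad m I I B $$ (i, j) = (if i \<in> I \<and> j \<in> I then entry I B i j else 0)"
  by (simp add: pad_def entry_def)

lemma pad_carrier [simp]: "pad m I J B \<in> carrier_mat m m"
  by (simp add: pad_def)

lemma submatrix_carrier:
  assumes "M \<in> carrier_mat m m" "I \<subseteq> {0..<m}"
  shows "submatrix M I I \<in> carrier_mat (card I) (card I)"
proof -
  have "{i. i < m \<and> i \<in> I} = I" using assms by auto
  then show ?thesis using assms by (auto simp: dim_submatrix)
qed

lemma entry_submatrix:
  assumes "M \<in> carrier_mat m m" "I \<subseteq> {0..<m}" "i \<in> I" "j \<in> I"
  shows "entry I (submatrix M I I) i j = M $$ (i, j)"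
  using assms unfolding entry_def by (intro submatrix_index_card) auto

lemma entry_transpose:
  assumes "finite I" "A \<in> carrier_mat (card I) (card I)" "i \<in> I" "j \<in> I"
  shows "entry I (A\<^sup>T) i j = entry I A j i"
  using assms position_less[of I] by (simp add: entry_def)

lemma entry_symmetric:
  assumes "finite I" "A \<in> carrier_mat (card I) (card I)" "A\<^sup>T = A" "i \<in> I" "j \<in> I"
  shows "entry I A i j = entry I A j i"
  using entry_transpose[OF assms(1,2,4,5)] assms(3) by simp

lemma submatrix_symmetric:
  fixes M :: "real mat"
  assumes M: "M \<in> carrier_mat m m" "M\<^sup>T = M" and I: "I \<subseteq> {0..<m}"
  shows "(submatrix M I I)\<^sup>T = submatrix M I I"
proof (rule mat_eq_entryI[of I])
  show f: "finite I" using I finite_subset by blast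
  show "submatrix M I I \<in> carrier_mat (card I) (card I)" by (rule submatrix_carrier[OF M(1) I])
  then show "(submatrix M I I)\<^sup>T \<in> carrier_mat (card I) (card I)" by simp
  fix i j assume ij: "i \<in> I" "j \<in> I"
  then have "i < m" "j < m" using I by auto
  then show "entry I ((submatrix M I I)\<^sup>T) i j = entry I (submatrix M I I) i j"
    using symmetric_index[OF M]
    by (simp add: entry_transpose[OF f submatrix_carrier[OF M(1) I] ij] entry_submatrix[OF M(1) I] ij)
qed

text \<open>The form of the submatrix is the form of \<open>M\<close> on vectors extended by zero.\<close>
lemma submatrix_PD:
  assumes M: "M \<in> PD m" and I: "I \<subseteq> {0..<m}"
  shows "submatrix M I I \<in> PD (card I)"
proof (rule PD_I)
  note cM = PD_D(1,2)[OF M]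
  have f: "finite I" using I finite_subset by blast
  let ?N = "submatrix M I I"
  show N: "?N \<in> carrier_mat (card I) (card I)" by (rule submatrix_carrier[OF cM(1) I])
  show "?N\<^sup>T = ?N" by (rule submatrix_symmetric[OF cM I])
  fix x :: "real vec" assume x: "x \<in> carrier_vec (card I)" "x \<noteq> 0\<^sub>v (card I)"
  define g where "g i = (if i \<in> I then x $ card {k\<in>I. k < i} else 0)" for i
  define y where "y = vec m g"
  have y: "y \<in> carrier_vec m" by (simp add: y_def)
  have gx: "g (pick I a) = x $ a" if "a < card I" for a
    using that by (simp add: g_def card_pick pick_in_set)
  obtain a where a: "a < card I" "x $ a \<noteq> 0" using x
    by (metis carrier_vecD eq_vecI index_zero_vec)
  have "pick I a < m" using pick_in_set[of a I] a I by auto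
  then have "y $ pick I a \<noteq> 0" using a gx by (simp add: y_def)
  then have y0: "y \<noteq> 0\<^sub>v m" using \<open>pick I a < m\<close> by auto
  have "x \<bullet> (?N *\<^sub>v x) = (\<Sum>a<card I. \<Sum>b<card I. g (pick I a) * M $$ (pick I a, pick I b) * g (pick I b))"
    unfolding bilinear_form_sum[OF N x(1) x(1)]
    by (intro sum.cong refl)
      (simp add: gx entry_pick[symmetric] entry_submatrix[OF cM(1) I] pick_in_set)
  also have "\<dots> = (\<Sum>a<card I. \<Sum>j\<in>I. g (pick I a) * M $$ (pick I a, j) * g j)"
    by (intro sum.cong refl sum_pick[OF f])
  also have "\<dots> = (\<Sum>i\<in>I. \<Sum>j\<in>I. g i * M $$ (i, j) * g j)" by (rule sum_pick[OF f])
  also have "\<dots> = (\<Sum>i\<in>I. \<Sum>j<m. g i * M $$ (i, j) * g j)"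
    using I by (intro sum.cong refl sum.mono_neutral_left) (auto simp: g_def)
  also have "\<dots> = (\<Sum>i<m. \<Sum>j<m. g i * M $$ (i, j) * g j)"
    using I by (intro sum.mono_neutral_left) (auto simp: g_def)
  also have "\<dots> = y \<bullet> (M *\<^sub>v y)"
    unfolding bilinear_form_sum[OF cM(1) y y] by (simp add: y_def)
  finally show "x \<bullet> (?N *\<^sub>v x) > 0" using PD_D(3)[OF M y y0] by simp
qed

lemma inverse_entries:
  assumes A: "A \<in> PD (card I)" and I: "finite I" and ij: "i \<in> I" "j \<in> I"
  shows "(\<Sum>k\<in>I. entry I (minv A) i k * entry I A k j) = (if i = j then 1 else 0)"
    and "(\<Sum>k\<in>I. entry I A i k * entry I (minv A) k j) = (if i = j then 1 else 0)"
  using entry_mult[OF I PD_minv(1)[OF A A] PD_D(1)[OF A] ij] entry_mult[OF I PD_D(1)[OF A] PD_minv(1)[OF A A] ij]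
  by (simp_all add: PD_minv[OF A A] entry_one[OF I ij])

text \<open>A single row suffices: multiply it from the right by the inverse.\<close>
lemma left_inverse_row_unique:
  assumes A: "A \<in> PD (card I)" and I: "finite I" and i: "i \<in> I" and l: "l \<in> I"
    and row: "\<And>j. j \<in> I \<Longrightarrow> (\<Sum>k\<in>I. r k * entry I A k j) = (if i = j then 1 else 0)"
  shows "entry I (minv A) i l = r l"
proof -
  have "entry I (minv A) i l = (\<Sum>j\<in>I. (if i = j then 1 else 0) * entry I (minv A) j l)"
    using I i by (simp add: if_distrib[of "\<lambda>x. x * _"] cong: if_cong)
  also have "\<dots> = (\<Sum>j\<in>I. (\<Sum>k\<in>I. r k * entry I A k j) * entry I (minv A) j l)"
    by (intro sum.cong refl) (simp add: row)
  also have "\<dots> = (\<Sum>k\<in>I. r k * (\<Sum>j\<in>I. entry I A k j * entry I (minv A) j l))"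
    by (simp add: sum_distrib_left sum_distrib_right mult.assoc) (rule sum.swap)
  also have "\<dots> = (\<Sum>k\<in>I. r k * (if k = l then 1 else 0))"
    by (intro sum.cong refl) (simp add: inverse_entries(2)[OF A I _ l])
  also have "\<dots> = r l" using I l by (simp add: if_distrib[of "\<lambda>x. _ * x"] cong: if_cong)
  finally show ?thesis .
qed

lemma log_Vor_entries:
  assumes n: "n \<ge> 1" and Sig: "\<Sigma> \<in> graphical_model V E" and V: "finite V"
  shows "log_Vor n V E \<Sigma> = {S \<in> PD (card V). \<forall>i\<in>V. \<forall>j\<in>V.
     i = j \<or> {i, j} \<in> E \<longrightarrow> entry V S i j = entry V \<Sigma> i j}"
proof -
  have inj: "a = b" if "pick V a = pick V b" "a < card V" "b < card V" for a b
    using that bij_betw_pick[OF V] by (auto simp: bij_betw_def inj_on_def)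
  have "(\<forall>a<card V. \<forall>b<card V. a = b \<or> {pick V a, pick V b} \<in> E \<longrightarrow> S $$ (a, b) = \<Sigma> $$ (a, b))
    \<longleftrightarrow> (\<forall>i\<in>V. \<forall>j\<in>V. i = j \<or> {i, j} \<in> E \<longrightarrow> entry V S i j = entry V \<Sigma> i j)" for S
    unfolding ball_pick[OF V, symmetric] using inj by (fastforce simp: entry_pick)
  then show ?thesis unfolding log_Vor_eq[OF n Sig] by simp
qed

lemma graphical_model_entries:
  assumes V: "finite V"
  shows "graphical_model V E = {\<Sigma> \<in> PD (card V). \<forall>i\<in>V. \<forall>j\<in>V.
     i \<noteq> j \<and> {i, j} \<notin> E \<longrightarrow> entry V (minv \<Sigma>) i j = 0}"
proof -
  have inj: "a = b" if "pick V a = pick V b" "a < card V" "b < card V" for a b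
    using that bij_betw_pick[OF V] by (auto simp: bij_betw_def inj_on_def)
  have "(\<forall>a<card V. \<forall>b<card V. a \<noteq> b \<and> {pick V a, pick V b} \<notin> E \<longrightarrow> M $$ (a, b) = 0)
    \<longleftrightarrow> (\<forall>i\<in>V. \<forall>j\<in>V. i \<noteq> j \<and> {i, j} \<notin> E \<longrightarrow> entry V M i j = 0)" for M
    unfolding ball_pick[OF V, symmetric] using inj by (fastforce simp: entry_pick)
  then show ?thesis unfolding graphical_model_def by simp
qed

section \<open>Gluing two matrices along a common block\<close>

text \<open>One column of the identity \<open>M X = 1\<close> for \<open>M = [P] + [R] - [D]\<close>, where \<open>P\<close> and \<open>R\<close> are the
  inverses of \<open>S\<^sub>1\<close> and \<open>S\<^sub>2\<close>, and \<open>D\<close> stands for the inverse of their common block on \<open>T\<close>. The column \<open>x\<close> belongs to an index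
  \<open>j \<in> U\<close>: on \<open>U\<close> it is the column of \<open>S\<^sub>1\<close>, and on \<open>W\<close> it is \<open>S\<^sub>2\<close>, columns \<open>T\<close>, times \<open>c\<close>, where
  \<open>c\<close> is \<open>D\<close> times the part on \<open>T\<close> of the column of \<open>S\<^sub>1\<close>. Then \<open>[P] x\<close> is already the unit vector,
  while \<open>[R] x\<close> and \<open>[D] x\<close> both equal \<open>c\<close> on \<open>T\<close> and cancel. The roles of \<open>U\<close> and \<open>W\<close> may be
  exchanged, which covers the columns \<open>j \<in> W\<close>.\<close>
lemma glue_column:
  fixes P R D S\<^sub>1 S\<^sub>2 :: "nat \<Rightarrow> nat \<Rightarrow> real" and x :: "nat \<Rightarrow> real"
  assumes U: "finite U" and W: "finite W" and T: "T = U \<inter> W" and j: "j \<in> U"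
    and P: "\<And>i. i \<in> U \<Longrightarrow> (\<Sum>k\<in>U. P i k * S\<^sub>1 k j) = (if i = j then 1 else 0)"
    and R: "\<And>i t. i \<in> W \<Longrightarrow> t \<in> W \<Longrightarrow> (\<Sum>k\<in>W. R i k * S\<^sub>2 k t) = (if i = t then 1 else 0)"
    and xU: "\<And>k. k \<in> U \<Longrightarrow> x k = S\<^sub>1 k j"
    and xW: "\<And>k. k \<in> W \<Longrightarrow> x k = (\<Sum>t\<in>T. S\<^sub>2 k t * (\<Sum>s\<in>T. D t s * S\<^sub>1 s j))"
    and i: "i \<in> U \<union> W"
  shows "(\<Sum>k\<in>U \<union> W. ((if i \<in> U \<and> k \<in> U then P i k else 0) + (if i \<in> W \<and> k \<in> W then R i k else 0)
      - (if i \<in> T \<and> k \<in> T then D i k else 0)) * x k) = (if i = j then 1 else 0)"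
proof -
  define c where "c t = (\<Sum>s\<in>T. D t s * S\<^sub>1 s j)" for t
  have fT: "finite T" using U T by simp
  have restrict: "(\<Sum>k\<in>U \<union> W. (if i \<in> A \<and> k \<in> A then F k else 0) * x k) = (if i \<in> A then \<Sum>k\<in>A. F k * x k else 0)"
    if "A \<subseteq> U \<union> W" for A and F :: "nat \<Rightarrow> real"
  proof (cases "i \<in> A")
    case True
    then show ?thesis using U W that
      by simp (intro sum.mono_neutral_cong_right; auto)
  qed simp
  have TUW: "T \<subseteq> U \<union> W" using T by blast
  have PU: "(\<Sum>k\<in>U. P i k * x k) = (if i = j then 1 else 0)" if "i \<in> U"
    using P[OF that] by (simp add: xU cong: sum.cong)
  have RW: "(\<Sum>k\<in>W. R i k * x k) = (if i \<in> T then c i else 0)" if "i \<in> W"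
  proof -
    have "(\<Sum>k\<in>W. R i k * x k) = (\<Sum>k\<in>W. \<Sum>t\<in>T. R i k * S\<^sub>2 k t * c t)"
      by (intro sum.cong refl) (simp add: xW c_def[symmetric] sum_distrib_left mult.assoc)
    also have "\<dots> = (\<Sum>t\<in>T. (\<Sum>k\<in>W. R i k * S\<^sub>2 k t) * c t)"
      unfolding sum_distrib_right by (rule sum.swap)
    also have "\<dots> = (\<Sum>t\<in>T. (if i = t then 1 else 0) * c t)"
      using T by (intro sum.cong refl) (simp add: R[OF that])
    also have "\<dots> = (if i \<in> T then c i else 0)"
      using fT by (simp add: if_distrib[of "\<lambda>x. x * _"] cong: if_cong)
    finally show ?thesis .
  qed
  have DT: "(\<Sum>k\<in>T. D i k * x k) = c i"
    unfolding c_def using T by (intro sum.cong refl) (simp add: xU)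
  have "(\<Sum>k\<in>U \<union> W. ((if i \<in> U \<and> k \<in> U then P i k else 0) + (if i \<in> W \<and> k \<in> W then R i k else 0)
      - (if i \<in> T \<and> k \<in> T then D i k else 0)) * x k)
    = (if i \<in> U then \<Sum>k\<in>U. P i k * x k else 0) + (if i \<in> W then \<Sum>k\<in>W. R i k * x k else 0)
      - (if i \<in> T then \<Sum>k\<in>T. D i k * x k else 0)"
    using restrict[OF Un_upper1, of "P i"] restrict[OF Un_upper2, of "R i"] restrict[OF TUW, of "D i"]
    by (simp only: left_diff_distrib distrib_right sum.distrib sum_subtractf)
  also have "\<dots> = (if i = j then 1 else 0)"
    using i j T PU RW DT by auto
  finally show ?thesis .
qed

text \<open>The inverse \<open>X\<close> is written down explicitly: its blocks on \<open>U\<close> and \<open>W\<close> are \<open>S\<^sub>1\<close> and \<open>S\<^sub>2\<close>, and between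
  \<open>W - T\<close> and \<open>U - T\<close> it is \<open>(S\<^sub>2)\<^bsub>WT\<^esub> Q\<^sup>-\<^sup>1 (S\<^sub>1)\<^bsub>TU\<^esub>\<close>, as conditional independence given \<open>T\<close> demands.\<close>
lemma glue_inverse:
  assumes U: "U \<subseteq> {0..<m}" and W: "W \<subseteq> {0..<m}" and UW: "U \<union> W = {0..<m}" and T: "T = U \<inter> W"
    and S\<^sub>1: "S\<^sub>1 \<in> PD (card U)" and S\<^sub>2: "S\<^sub>2 \<in> PD (card W)" and Q: "Q \<in> PD (card T)"
    and Q1: "\<And>i j. i \<in> T \<Longrightarrow> j \<in> T \<Longrightarrow> entry U S\<^sub>1 i j = entry T Q i j"
    and Q2: "\<And>i j. i \<in> T \<Longrightarrow> j \<in> T \<Longrightarrow> entry W S\<^sub>2 i j = entry T Q i j"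
  defines "X \<equiv> minv (pad m U U (minv S\<^sub>1) + pad m W W (minv S\<^sub>2) - pad m T T (minv Q))"
  shows "X \<in> Sym m" "submatrix X U U = S\<^sub>1" "submatrix X W W = S\<^sub>2"
proof -
  have fU: "finite U" and fW: "finite W" and fT: "finite T"
    using U W T finite_subset by (blast, blast, blast)
  define s1 where "s1 = entry U S\<^sub>1"
  define s2 where "s2 = entry W S\<^sub>2"
  define q where "q = entry T Q"
  define P where "P = entry U (minv S\<^sub>1)"
  define R where "R = entry W (minv S\<^sub>2)"
  define D where "D = entry T (minv Q)"
  have s1_sym: "s1 i j = s1 j i" if "i \<in> U" "j \<in> U" for i j
    unfolding s1_def by (rule entry_symmetric[OF fU PD_D(1,2)[OF S\<^sub>1] that])
  have s2_sym: "s2 i j = s2 j i" if "i \<in> W" "j \<in> W" for i j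
    unfolding s2_def by (rule entry_symmetric[OF fW PD_D(1,2)[OF S\<^sub>2] that])
  have D_sym: "D i j = D j i" if "i \<in> T" "j \<in> T" for i j
    unfolding D_def by (rule entry_symmetric[OF fT PD_D(1,2)[OF PD_inverse[OF Q]] that])
  have s1_T: "s1 i j = q i j" and s2_T: "s2 i j = q i j" if "i \<in> T" "j \<in> T" for i j
    using Q1 Q2 that by (auto simp: s1_def s2_def q_def)
  have PS: "(\<Sum>k\<in>U. P i k * s1 k j) = (if i = j then 1 else 0)" if "i \<in> U" "j \<in> U" for i j
    unfolding P_def s1_def by (rule inverse_entries(1)[OF S\<^sub>1 fU that])
  have RS: "(\<Sum>k\<in>W. R i k * s2 k j) = (if i = j then 1 else 0)" if "i \<in> W" "j \<in> W" for i j
    unfolding R_def s2_def by (rule inverse_entries(1)[OF S\<^sub>2 fW that])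
  have DQ: "(\<Sum>k\<in>T. D i k * q k j) = (if i = j then 1 else 0)"
    and QD: "(\<Sum>k\<in>T. q i k * D k j) = (if i = j then 1 else 0)" if "i \<in> T" "j \<in> T" for i j
    unfolding D_def q_def by (rule inverse_entries[OF Q fT that])+
  \<comment> \<open>the cross block; on \<open>T\<close> it continues both \<open>S\<^sub>1\<close> and \<open>S\<^sub>2\<close>, so overlapping cases agree\<close>
  define C where "C i j = (\<Sum>t\<in>T. s2 i t * (\<Sum>s\<in>T. D t s * s1 s j))" for i j
  have C_left: "C i j = s1 i j" if "i \<in> T" "j \<in> U" for i j
  proof -
    have "C i j = (\<Sum>t\<in>T. \<Sum>s\<in>T. q i t * D t s * s1 s j)"
      unfolding C_def using that
      by (intro sum.cong refl) (simp add: s2_T sum_distrib_left mult.assoc)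
    also have "\<dots> = (\<Sum>s\<in>T. (\<Sum>t\<in>T. q i t * D t s) * s1 s j)"
      unfolding sum_distrib_right by (rule sum.swap)
    also have "\<dots> = (\<Sum>s\<in>T. (if i = s then 1 else 0) * s1 s j)"
      by (intro sum.cong refl) (simp add: QD[OF that(1)])
    also have "\<dots> = s1 i j"
      using fT that by (simp add: if_distrib[of "\<lambda>x. x * _"] cong: if_cong)
    finally show ?thesis .
  qed
  have C_right: "C i j = s2 i j" if "i \<in> W" "j \<in> T" for i j
  proof -
    have "(\<Sum>s\<in>T. D t s * s1 s j) = (if t = j then 1 else 0)" if "t \<in> T" for t
      using DQ[OF that \<open>j \<in> T\<close>] s1_T[OF _ \<open>j \<in> T\<close>] by (simp cong: sum.cong)
    then have "C i j = (\<Sum>t\<in>T. s2 i t * (if t = j then 1 else 0))"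
      unfolding C_def by (intro sum.cong refl) simp
    also have "\<dots> = s2 i j"
      using fT that by (simp add: if_distrib[of "\<lambda>x. _ * x"] cong: if_cong)
    finally show ?thesis .
  qed
  have C_swap: "C j i = (\<Sum>t\<in>T. s1 i t * (\<Sum>s\<in>T. D t s * s2 s j))" if "i \<in> U" "j \<in> W" for i j
  proof -
    have "C j i = (\<Sum>t\<in>T. \<Sum>s\<in>T. s1 i s * (D s t * s2 t j))"
      unfolding C_def sum_distrib_left
      using that T s1_sym[of i] s2_sym[of j] D_sym by (intro sum.cong refl) simp
    also have "\<dots> = (\<Sum>s\<in>T. \<Sum>t\<in>T. s1 i s * (D s t * s2 t j))" by (rule sum.swap)
    finally show ?thesis unfolding sum_distrib_left .
  qed
  define x where "x i j = (if i \<in> U \<and> j \<in> U then s1 i j else if i \<in> W \<and> j \<in> W then s2 i j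
     else if i \<in> W then C i j else C j i)" for i j
  define Y where "Y = mat m m (\<lambda>(i, j). x i j)"
  have Y: "Y \<in> carrier_mat m m" by (simp add: Y_def)
  define M where "M = pad m U U (minv S\<^sub>1) + pad m W W (minv S\<^sub>2) - pad m T T (minv Q)"
  have M: "M \<in> carrier_mat m m" by (auto simp: M_def intro!: minus_carrier_mat)
  have M_index: "M $$ (i, k) = (if i \<in> U \<and> k \<in> U then P i k else 0) + (if i \<in> W \<and> k \<in> W then R i k else 0)
      - (if i \<in> T \<and> k \<in> T then D i k else 0)" if "i < m" "k < m" for i k
    using that carrier_matD[OF pad_carrier]
    by (simp add: M_def pad_index P_def R_def D_def)
  have colU: "x k j = s1 k j" if "k \<in> U" "j \<in> U" for k j using that by (simp add: x_def)
  have colUW: "x k j = C k j" if "k \<in> W" "j \<in> U" for k j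
    using that T C_left C_right by (simp add: x_def)
  have colW: "x k j = s2 k j" if "k \<in> W" "j \<in> W" for k j
    using that T s1_T s2_T by (simp add: x_def)
  have colWU: "x k j = C j k" if "k \<in> U" "j \<in> W" for k j
    using that T C_left[of j k] C_right[of j k] s1_sym[of k j] s2_sym[of k j] by (simp add: x_def)
  have x_sym: "x i j = x j i" if "i \<in> U \<union> W" "j \<in> U \<union> W" for i j
    using that s1_sym s2_sym by (auto simp: x_def)
  have prod: "(\<Sum>k\<in>U \<union> W. M $$ (i, k) * x k j) = (if i = j then 1 else 0)"
    if i: "i \<in> U \<union> W" and j: "j \<in> U \<union> W" for i j
  proof -
    have lt: "i < m" "\<And>k. k \<in> U \<union> W \<Longrightarrow> k < m" using i UW by auto
    have row: "(\<Sum>k\<in>U \<union> W. M $$ (i, k) * x k j) = (\<Sum>k\<in>U \<union> W.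
        ((if i \<in> U \<and> k \<in> U then P i k else 0) + (if i \<in> W \<and> k \<in> W then R i k else 0)
          - (if i \<in> T \<and> k \<in> T then D i k else 0)) * x k j)"
      by (intro sum.cong refl) (simp only: M_index[OF lt])
    show ?thesis
    proof (cases "j \<in> U")
      case True
      show ?thesis unfolding row
        using glue_column[where x = "\<lambda>k. x k j" and P = P and R = R and D = D and S\<^sub>1 = s1 and S\<^sub>2 = s2,
            OF fU fW T True PS[OF _ True] RS colU[OF _ True] colUW[OF _ True, unfolded C_def] i] .
    next
      case False
      then have jW: "j \<in> W" using j by simp
      have T': "T = W \<inter> U" and i': "i \<in> W \<union> U" using T i by auto
      show ?thesis unfolding row
        using glue_column[where x = "\<lambda>k. x k j" and P = R and R = P and D = D and S\<^sub>1 = s2 and S\<^sub>2 = s1,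
            OF fW fU T' jW RS[OF _ jW] PS colW[OF _ jW] trans[OF colWU[OF _ jW] C_swap[OF _ jW]] i']
        unfolding Un_commute[of W U] add.commute[of "if i \<in> W \<and> _ \<in> W then R i _ else 0"] .
    qed
  qed
  have "M * Y = 1\<^sub>m m"
  proof (rule eq_matI)
    fix i j assume "i < dim_row (1\<^sub>m m :: real mat)" "j < dim_col (1\<^sub>m m :: real mat)"
    then have ij: "i < m" "j < m" by auto
    have "(M * Y) $$ (i, j) = (\<Sum>k\<in>U \<union> W. M $$ (i, k) * x k j)"
      unfolding UW using ij M by (simp add: Y_def scalar_prod_def)
    then show "(M * Y) $$ (i, j) = (1\<^sub>m m :: real mat) $$ (i, j)"
      using prod[of i j] ij UW by simp
  qed (use M Y in auto)
  then have XY: "X = Y" unfolding X_def M_def[symmetric] by (rule minv_unique[OF M Y])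
  show "X \<in> Sym m"
    unfolding XY Sym_def using x_sym UW by (auto simp: Y_def)
  have Yx: "Y $$ (i, j) = x i j" if "i \<in> U \<union> W" "j \<in> U \<union> W" for i j
    using that UW by (simp add: Y_def)
  show "submatrix X U U = S\<^sub>1"
    unfolding XY
    by (rule mat_eq_entryI[OF fU submatrix_carrier[OF Y U] PD_D(1)[OF S\<^sub>1]])
      (simp add: entry_submatrix[OF Y U] Yx colU s1_def)
  show "submatrix X W W = S\<^sub>2"
    unfolding XY
    by (rule mat_eq_entryI[OF fW submatrix_carrier[OF Y W] PD_D(1)[OF S\<^sub>2]])
      (simp add: entry_submatrix[OF Y W] Yx colW s2_def)
qed

section \<open>Decompositions of graphs and of graphical models\<close>

text \<open>A vertex \<open>i \<in> U - W\<close> has no neighbour outside \<open>U\<close>, so row \<open>i\<close> of \<open>minv \<Sigma>\<close> lives on \<open>U\<close> and inverts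
  the block \<open>\<Sigma>\<^sub>U\<^sub>U\<close> in that row: it is row \<open>i\<close> of the inverse of the block. Non-edges inside \<open>U\<close>
  always involve such a vertex, because \<open>U \<inter> W\<close> is a clique of the smaller graph.\<close>
lemma marginal_model:
  assumes Sig: "\<Sigma> \<in> graphical_model {0..<m} E"
    and U: "U \<subseteq> {0..<m}" and UW: "U \<union> W = {0..<m}"
    and sep: "\<And>i j. i \<in> U - W \<Longrightarrow> j \<in> W - U \<Longrightarrow> {i, j} \<notin> E"
    and clique: "\<And>i j. i \<in> U \<inter> W \<Longrightarrow> j \<in> U \<inter> W \<Longrightarrow> i \<noteq> j \<Longrightarrow> {i, j} \<in> F"
    and edges: "\<And>i j. i \<in> U - W \<Longrightarrow> j \<in> U \<Longrightarrow> {i, j} \<in> E \<Longrightarrow> {i, j} \<in> F"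
  shows "submatrix \<Sigma> U U \<in> graphical_model U F"
proof -
  have fU: "finite U" using U finite_subset by blast
  have PS: "\<Sigma> \<in> PD m" using Sig by (simp add: graphical_model_def)
  note cS = PD_D(1,2)[OF PS] and i\<Sigma> = PD_minv[OF PS PS]
  have zero: "minv \<Sigma> $$ (i, j) = 0" if "i < m" "j < m" "i \<noteq> j" "{i, j} \<notin> E" for i j
    using Sig that by (auto simp: graphical_model_entries entry_interval)
  let ?N = "submatrix \<Sigma> U U"
  have N: "?N \<in> PD (card U)" by (rule submatrix_PD[OF PS U])
  have inv: "entry U (minv ?N) i l = minv \<Sigma> $$ (i, l)" if i: "i \<in> U - W" and l: "l \<in> U" for i l
  proof (rule left_inverse_row_unique[OF N fU _ l])
    show "i \<in> U" using i by simp
    fix j assume j: "j \<in> U"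
    have lt: "i < m" "j < m" using i j U by auto
    have "(\<Sum>k\<in>U. minv \<Sigma> $$ (i, k) * entry U ?N k j) = (\<Sum>k\<in>U. minv \<Sigma> $$ (i, k) * \<Sigma> $$ (k, j))"
      using j by (intro sum.cong refl) (simp add: entry_submatrix[OF cS(1) U])
    also have "\<dots> = (\<Sum>k\<in>{0..<m}. minv \<Sigma> $$ (i, k) * \<Sigma> $$ (k, j))"
    proof (intro sum.mono_neutral_left ballI)
      fix k assume "k \<in> {0..<m} - U"
      then have "k \<in> W - U" "k < m" "k \<noteq> i" using UW i by auto
      then show "minv \<Sigma> $$ (i, k) * \<Sigma> $$ (k, j) = 0" using sep[OF i] zero lt by auto
    qed (use U in auto)
    also have "\<dots> = (minv \<Sigma> * \<Sigma>) $$ (i, j)"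
      using lt cS i\<Sigma>(1) by (simp add: scalar_prod_def)
    also have "\<dots> = (if i = j then 1 else 0)" using lt i\<Sigma>(3) by simp
    finally show "(\<Sum>k\<in>U. minv \<Sigma> $$ (i, k) * entry U ?N k j) = (if i = j then 1 else 0)" .
  qed
  have *: "entry U (minv ?N) i l = 0" if "i \<in> U - W" "l \<in> U" "i \<noteq> l" "{i, l} \<notin> F" for i l
  proof -
    have "i < m" "l < m" using that U by auto
    then show ?thesis using inv[OF that(1,2)] zero[of i l] edges[OF that(1,2)] that by auto
  qed
  have "entry U (minv ?N) i l = 0" if il: "i \<in> U" "l \<in> U" "i \<noteq> l" "{i, l} \<notin> F" for i l
  proof -
    consider "i \<in> U - W" | "l \<in> U - W" using clique[of i l] il by blast
    then show ?thesis
    proof cases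
      case 2
      then show ?thesis
        using *[of l i] il entry_symmetric[OF fU PD_D(1,2)[OF PD_inverse[OF N]] il(1,2)]
        by (simp add: insert_commute)
    qed (use * il in blast)
  qed
  then show ?thesis using N by (auto simp: graphical_model_entries[OF fU])
qed

text \<open>Vertices and edges are the faces of the clique complex with one and two elements, so the equations
  between complexes can be read off on them.\<close>
lemma decomposition_vertices_edges:
  assumes G: "simple_graph V E"
    and red: "reducible_complex V (clique_complex V E) \<Gamma>\<^sub>1 T \<Gamma>\<^sub>2"
    and G1: "subgraph_of U E\<^sub>1 V E" "clique_complex U E\<^sub>1 = \<Gamma>\<^sub>1"
    and G2: "subgraph_of W E\<^sub>2 V E" "clique_complex W E\<^sub>2 = \<Gamma>\<^sub>2"
  shows "U \<union> W = V" "T = U \<inter> W" "E = E\<^sub>1 \<union> E\<^sub>2"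
    "\<And>i j. i \<in> T \<Longrightarrow> j \<in> T \<Longrightarrow> i \<noteq> j \<Longrightarrow> {i, j} \<in> E\<^sub>1 \<inter> E\<^sub>2"
    "\<And>i j. {i, j} \<in> E\<^sub>1 \<Longrightarrow> i \<in> U \<and> j \<in> U" "\<And>i j. {i, j} \<in> E\<^sub>2 \<Longrightarrow> i \<in> W \<and> j \<in> W"
proof -
  have union: "clique_complex V E = clique_complex U E\<^sub>1 \<union> clique_complex W E\<^sub>2"
    and inter: "clique_complex U E\<^sub>1 \<inter> clique_complex W E\<^sub>2 = Pow T"
    using red G1 G2 by (auto simp: reducible_complex_def)
  have single: "{i} \<in> clique_complex A F \<longleftrightarrow> i \<in> A" for i A F
    by (auto simp: clique_complex_def)
  have vertices: "i \<in> V \<longleftrightarrow> i \<in> U \<or> i \<in> W" "i \<in> T \<longleftrightarrow> i \<in> U \<and> i \<in> W" for i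
    using union inter single[of i] by (metis UnCI UnE, metis Int_iff Pow_iff empty_subsetI insert_subset)
  then show "U \<union> W = V" "T = U \<inter> W" by auto
  show "{i, j} \<in> E\<^sub>1 \<inter> E\<^sub>2" if "i \<in> T" "j \<in> T" "i \<noteq> j" for i j
  proof -
    have "{i, j} \<in> clique_complex U E\<^sub>1 \<inter> clique_complex W E\<^sub>2" using inter that by auto
    then show ?thesis using that by (auto simp: clique_complex_def)
  qed
  have "E \<subseteq> E\<^sub>1 \<union> E\<^sub>2"
  proof
    fix e assume e: "e \<in> E"
    then obtain i j where ij: "i \<in> V" "j \<in> V" "i \<noteq> j" "e = {i, j}"
      using G by (auto simp: simple_graph_def)
    then have "e \<in> clique_complex V E" using e by (auto simp: clique_complex_def insert_commute)
    then have "e \<in> clique_complex U E\<^sub>1 \<or> e \<in> clique_complex W E\<^sub>2" using union by blast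
    then show "e \<in> E\<^sub>1 \<union> E\<^sub>2" using ij by (auto simp: clique_complex_def)
  qed
  then show "E = E\<^sub>1 \<union> E\<^sub>2" using G1 G2 by (auto simp: subgraph_of_def)
  show "i \<in> U \<and> j \<in> U" if "{i, j} \<in> E\<^sub>1" for i j
    using G1(1) that by (fastforce simp: subgraph_of_def simple_graph_def doubleton_eq_iff)
  show "i \<in> W \<and> j \<in> W" if "{i, j} \<in> E\<^sub>2" for i j
    using G2(1) that by (fastforce simp: subgraph_of_def simple_graph_def doubleton_eq_iff)
qed

section \<open>The cell of a reducible model\<close>

text \<open>Turns membership of a difference in \<open>ker_\<psi>\<close> into equality of the two marginal blocks.\<close>
lemma submatrix_minus_eq_zero_iff:
  fixes A B :: "real mat"
  assumes "A \<in> carrier_mat m m" "B \<in> carrier_mat m m" "I \<subseteq> {0..<m}"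
  shows "submatrix (A - B) I I = 0\<^sub>m (card I) (card I) \<longleftrightarrow> submatrix A I I = submatrix B I I"
proof -
  have f: "finite I" using assms finite_subset by blast
  have AB: "A - B \<in> carrier_mat m m" using assms by (intro minus_carrier_mat)
  note car = submatrix_carrier[OF assms(1,3)] submatrix_carrier[OF assms(2,3)] submatrix_carrier[OF AB assms(3)]
  have ent: "submatrix M I I $$ (a, b) = M $$ (pick I a, pick I b)"
    if "a < card I" "b < card I" "M \<in> carrier_mat m m" for a b and M :: "real mat"
    using entry_submatrix[OF that(3) assms(3), of "pick I a" "pick I b"] that
    by (simp add: entry_pick pick_in_set)
  have lt: "pick I a < m" if "a < card I" for a using pick_in_set[of a I] that assms(3) by auto
  have "submatrix (A - B) I I = submatrix A I I - submatrix B I I"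
    using car assms(1,2) by (intro eq_matI) (auto simp: ent AB lt)
  then show ?thesis
    using car(1,2) by (auto simp: mat_eq_iff)
qed

theorem theorem3p6:
  fixes m n :: nat
    and E E\<^sub>1 E\<^sub>2 \<Gamma>\<^sub>1 \<Gamma>\<^sub>2 :: "nat set set"
    and U W T :: "nat set"
    and \<Sigma> :: "real mat"
  assumes "n \<ge> 1"
    and "simple_graph {0..<m} E"
    and "reducible_complex {0..<m} (clique_complex {0..<m} E) \<Gamma>\<^sub>1 T \<Gamma>\<^sub>2"
    and "subgraph_of U E\<^sub>1 {0..<m} E" and "clique_complex U E\<^sub>1 = \<Gamma>\<^sub>1"
    and "subgraph_of W E\<^sub>2 {0..<m} E" and "clique_complex W E\<^sub>2 = \<Gamma>\<^sub>2"
    and "\<Sigma> \<in> graphical_model {0..<m} E"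
  shows "log_Vor n {0..<m} E \<Sigma> =
    ({minv (pad m U U (minv S\<^sub>1) + pad m W W (minv S\<^sub>2) - pad m T T (minv (submatrix \<Sigma> T T))) | S\<^sub>1 S\<^sub>2.
        S\<^sub>1 \<in> log_Vor n U E\<^sub>1 (submatrix \<Sigma> U U) \<and> S\<^sub>2 \<in> log_Vor n W E\<^sub>2 (submatrix \<Sigma> W W)}
      + ker_\<psi> m U W) \<inter> PD m"
proof -
  note UW = decomposition_vertices_edges(1)[OF assms(2-7)]
    and T = decomposition_vertices_edges(2)[OF assms(2-7)]
    and E = decomposition_vertices_edges(3)[OF assms(2-7)]
    and clique = decomposition_vertices_edges(4)[OF assms(2-7)]
    and E1 = decomposition_vertices_edges(5)[OF assms(2-7)]
    and E2 = decomposition_vertices_edges(6)[OF assms(2-7)]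
  have U: "U \<subseteq> {0..<m}" and W: "W \<subseteq> {0..<m}" and TV: "T \<subseteq> {0..<m}" using UW T by auto
  have fU: "finite U" and fW: "finite W" using U W finite_subset by (blast, blast)
  have PS: "\<Sigma> \<in> PD m" using assms(8) by (simp add: graphical_model_def)
  note cSig = PD_D(1)[OF PS]
  have mU: "submatrix \<Sigma> U U \<in> graphical_model U E\<^sub>1"
    by (rule marginal_model[OF assms(8) U UW]) (use E E1 E2 T clique in blast)+
  have mW: "submatrix \<Sigma> W W \<in> graphical_model W E\<^sub>2"
    by (rule marginal_model[OF assms(8) W, of U]) (use UW E E1 E2 T clique in blast)+
  note entU = entry_submatrix[OF _ U] and entW = entry_submatrix[OF _ W]
  have VU: "S \<in> log_Vor n U E\<^sub>1 (submatrix \<Sigma> U U) \<longleftrightarrow> S \<in> PD (card U) \<and>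
      (\<forall>i\<in>U. \<forall>j\<in>U. i = j \<or> {i, j} \<in> E\<^sub>1 \<longrightarrow> entry U S i j = \<Sigma> $$ (i, j))" for S
    unfolding log_Vor_entries[OF assms(1) mU fU] by (auto simp: entU[OF cSig])
  have VW: "S \<in> log_Vor n W E\<^sub>2 (submatrix \<Sigma> W W) \<longleftrightarrow> S \<in> PD (card W) \<and>
      (\<forall>i\<in>W. \<forall>j\<in>W. i = j \<or> {i, j} \<in> E\<^sub>2 \<longrightarrow> entry W S i j = \<Sigma> $$ (i, j))" for S
    unfolding log_Vor_entries[OF assms(1) mW fW] by (auto simp: entW[OF cSig])
  have V: "S \<in> log_Vor n {0..<m} E \<Sigma> \<longleftrightarrow> S \<in> PD m \<and>
      (\<forall>i<m. \<forall>j<m. i = j \<or> {i, j} \<in> E \<longrightarrow> S $$ (i, j) = \<Sigma> $$ (i, j))" for S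
    unfolding log_Vor_entries[OF assms(1,8) finite_atLeastLessThan] by (auto simp: entry_interval)
  \<comment> \<open>the likelihood equations of \<open>G\<close> are those of the two parts taken together\<close>
  have restrict: "S \<in> log_Vor n {0..<m} E \<Sigma> \<longleftrightarrow>
      submatrix S U U \<in> log_Vor n U E\<^sub>1 (submatrix \<Sigma> U U) \<and>
      submatrix S W W \<in> log_Vor n W E\<^sub>2 (submatrix \<Sigma> W W)" (is "_ \<longleftrightarrow> ?R") if S: "S \<in> PD m" for S
  proof
    assume "S \<in> log_Vor n {0..<m} E \<Sigma>"
    then have eq: "S $$ (i, j) = \<Sigma> $$ (i, j)" if "i < m" "j < m" "i = j \<or> {i, j} \<in> E" for i j
      using that V by auto
    have "i < m" if "i \<in> U \<or> i \<in> W" for i using that U W by auto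
    then show ?R
      unfolding VU VW using submatrix_PD[OF S U] submatrix_PD[OF S W] E eq
      by (auto simp: entU[OF PD_D(1)[OF S]] entW[OF PD_D(1)[OF S]])
  next
    assume R: ?R
    have "S $$ (i, j) = \<Sigma> $$ (i, j)" if ij: "i = j \<or> {i, j} \<in> E" "i < m" "j < m" for i j
    proof -
      consider "i \<in> U" "j \<in> U" "i = j \<or> {i, j} \<in> E\<^sub>1" | "i \<in> W" "j \<in> W" "i = j \<or> {i, j} \<in> E\<^sub>2"
        using ij UW E E1 E2 by (metis UnE atLeastLessThan_iff zero_le)
      then show ?thesis
        using R unfolding VU VW
        by cases (auto simp: entU[OF PD_D(1)[OF S]] entW[OF PD_D(1)[OF S]])
    qed
    then show "S \<in> log_Vor n {0..<m} E \<Sigma>" unfolding V using S by blast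
  qed
  \<comment> \<open>both blocks agree with \<open>\<Sigma>\<close> on \<open>T\<close>, a clique of both parts, so they can be glued\<close>
  define X where "X S\<^sub>1 S\<^sub>2 = minv (pad m U U (minv S\<^sub>1) + pad m W W (minv S\<^sub>2) - pad m T T (minv (submatrix \<Sigma> T T)))"
    for S\<^sub>1 S\<^sub>2
  have X: "X S\<^sub>1 S\<^sub>2 \<in> Sym m \<and> submatrix (X S\<^sub>1 S\<^sub>2) U U = S\<^sub>1 \<and> submatrix (X S\<^sub>1 S\<^sub>2) W W = S\<^sub>2"
    if S: "S\<^sub>1 \<in> log_Vor n U E\<^sub>1 (submatrix \<Sigma> U U)" "S\<^sub>2 \<in> log_Vor n W E\<^sub>2 (submatrix \<Sigma> W W)" for S\<^sub>1 S\<^sub>2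
  proof -
    have P: "S\<^sub>1 \<in> PD (card U)" "S\<^sub>2 \<in> PD (card W)" using S VU VW by auto
    have T1: "entry U S\<^sub>1 i j = entry T (submatrix \<Sigma> T T) i j"
      and T2: "entry W S\<^sub>2 i j = entry T (submatrix \<Sigma> T T) i j" if "i \<in> T" "j \<in> T" for i j
      using S clique[OF that] that T unfolding VU VW entry_submatrix[OF cSig TV that] by auto
    show ?thesis
      unfolding X_def using glue_inverse[OF U W UW T P submatrix_PD[OF PS TV] T1 T2] by blast
  qed
  show ?thesis (is "?L = (?A + ?K) \<inter> PD m")
  proof (intro equalityI subsetI)
    fix S assume SV: "S \<in> ?L"
    then have S: "S \<in> PD m" using V by blast
    define X' where "X' = X (submatrix S U U) (submatrix S W W)"
    have SS: "submatrix S U U \<in> log_Vor n U E\<^sub>1 (submatrix \<Sigma> U U)"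
      "submatrix S W W \<in> log_Vor n W E\<^sub>2 (submatrix \<Sigma> W W)" using restrict[OF S] SV by auto
    then have X': "X' \<in> Sym m" "submatrix X' U U = submatrix S U U" "submatrix X' W W = submatrix S W W"
      using X[OF SS] by (auto simp: X'_def)
    have c: "S \<in> carrier_mat m m" "S\<^sup>T = S" "X' \<in> carrier_mat m m" "X'\<^sup>T = X'"
      using S X' by (auto simp: PD_def Sym_def)
    have "(S - X')\<^sup>T = S - X'" using c by (simp add: transpose_minus[of _ m m])
    then have "S - X' \<in> ?K"
      using c X' submatrix_minus_eq_zero_iff[OF c(1,3) U] submatrix_minus_eq_zero_iff[OF c(1,3) W]
      by (simp add: ker_\<psi>_def \<psi>_def Sym_def minus_carrier_mat)
    moreover have "X' \<in> ?A" using SS unfolding X'_def X_def by blast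
    ultimately have "X' + (S - X') \<in> ?A + ?K" by (intro set_plus_intro)
    moreover have "X' + (S - X') = S" using c by (intro eq_matI) auto
    ultimately show "S \<in> (?A + ?K) \<inter> PD m" using S by simp
  next
    fix S assume "S \<in> (?A + ?K) \<inter> PD m"
    then obtain A N where S: "S \<in> PD m" and SAN: "S = A + N" and A: "A \<in> ?A" and N: "N \<in> ?K"
      by (blast elim: set_plus_elim)
    from A obtain S\<^sub>1 S\<^sub>2 where AX: "A = X S\<^sub>1 S\<^sub>2"
      and S12: "S\<^sub>1 \<in> log_Vor n U E\<^sub>1 (submatrix \<Sigma> U U)" "S\<^sub>2 \<in> log_Vor n W E\<^sub>2 (submatrix \<Sigma> W W)"
      unfolding X_def by blast
    note X' = X[OF S12]
    have c: "S \<in> carrier_mat m m" "X S\<^sub>1 S\<^sub>2 \<in> carrier_mat m m" "N \<in> carrier_mat m m"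
      using S X' N by (auto simp: PD_def Sym_def ker_\<psi>_def)
    have "N = S - X S\<^sub>1 S\<^sub>2" using c SAN AX by (intro eq_matI) auto
    then have "submatrix S U U = S\<^sub>1" "submatrix S W W = S\<^sub>2"
      using N X' submatrix_minus_eq_zero_iff[OF c(1,2) U] submatrix_minus_eq_zero_iff[OF c(1,2) W]
      by (auto simp: ker_\<psi>_def \<psi>_def)
    then show "S \<in> ?L" using restrict[OF S] S12 by simp
  qed
qed

end
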